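(* Let $X,Y$ be Hilbert spaces and $A\colon X\to Y$ a bounded linear operator. Let $\mathbf L=\mathrm{Id}_X+(\mathrm{Id}_X-A^+A)\mathbf N$ be a null space network, with $(\mathrm{Id}_X-A^+A)\mathbf N$ Lipschitz continuous. Let $\mu,\rho>0$ and let $(g_\alpha)_{\alpha>0}$ be a regularizing filter such that there exist constants $\alpha_0,c_1,c_2>0$ with - for all $\alpha>0$ and all $\lambda\in[0,\|A^*A\|]$: $\lambda^\mu|1-\lambda g_\alpha(\lambda)|\le c_1\alpha^\mu$; - for all $\alpha\in(0,\alpha_0)$: $\|g_\alpha\|_\infty\le c_2/\alpha$. Let $\alpha^\star\colon(0,\infty)\times Y\to(0,\infty)$ be a parameter choice with $\alpha^\star\asymp(\delta/\rho)^{\frac{2}{2\mu+1}}$ as $\delta\to0$, and let $(Q_\alpha)_{\alpha>0}$ be a family of bounded linear operators on $X$ such that, for $\alpha=\alpha^\star(\delta,y^\delta)$, $\|Q_\alpha-P_{\ker(A)}\|=\mathcal O\big(\delta^{\frac{2\mu}{2\mu+1}}\big)$ as $\delta\to0$, uniformly in $y^\delta\in Y$. Set $$R_\alpha:=(\mathrm{Id}_X+Q_\alpha\mathbf N)\circ g_\alpha(A^*A)A^*.$$ Then for any $x\in\operatorname{ran}\big(\mathbf L\circ(A^*A)^\mu\big)$ one has, as $\delta\to0$ and for $y^\delta\in Y$ with $\|Ax-y^\delta\|\le\delta$, the convergence rate $$\|R_{\alpha^\star(\delta,y^\delta)}(y^\delta)-x\|=\mathcal O\big(\delta^{\frac{2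\mu}{2\mu+1}}\big).$$
   Context: $A^+$ denotes the Moore-Penrose generalized inverse of $A$, and $P_{\ker(A)}=\mathrm{Id}_X-A^+A$ is the orthogonal projector onto $\ker(A)$. Layered feed forward network: for Hilbert spaces $X,Z$, a function $\mathbf N\colon X\to Z$ of the form $\mathbf N=\sigma_L\circ\mathbf W_L\circ\sigma_{L-1}\circ\mathbf W_{L-1}\circ\cdots\circ\sigma_1\circ\mathbf W_1$ with $L\in\mathbb N$, where $X_0=X,X_1,\dots,X_L=Z$ are Hilbert spaces, $\mathbf W_\ell\colon X_{\ell-1}\to X_\ell$ are affine and continuous, and $\sigma_\ell\colon X_\ell\to X_\ell$ are continuous. Null space network: a function $\mathbf L\colon X\to X$ of the form $\mathbf L=\mathrm{Id}_X+(\mathrm{Id}_X-A^+A)\mathbf N$ with $\mathbf N\colon X\to X$ a layered feed forward network. A family $(g_\alpha)_{\alpha>0}$ of functions $g_\alpha\colon[0,\|A^*A\|]\to\mathbb R$ is called a regularizing filter if: each $g_\alpha$ is piecewise continuous; there is $C>0$ with $\sup\{|\lambda g_\alpha(\lambda)|\mid\alpha>0,\ \lambda\in[0,\|A^*A\|]\}\le C$; and $\lim_{\alpha\to0}g_\alpha(\lambda)=1/\lambda$ for all $\lambda\in(0,\|A^*A\|]$. The operators $g_\alpha(A^*A)$ and $(A^*A)^\mu$ are defined by the functional calculus for the bounded self-adjoint operator $A^*A$. Notation: $\alpha^\star\asymp(\delta/\rho)^a$ as $\delta\to0$ means that there are constants $d_1,d_2>0$ such that $d_1(\delta/\rho)^a\le\alpha^\star(\delta,y^\delta)\le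 d_2(\delta/\rho)^a$ for all sufficiently small $\delta>0$ and all $y^\delta\in Y$. *)

theory Defs
  imports "HOL-Analysis.Analysis"
begin

text \<open>Hilbert spaces are types of sort \<open>{real_inner, complete_space}\<close>. A complex Hilbert space is
  covered through its underlying real one (inner product \<open>Re \<langle>x, y\<rangle>\<close>), which changes neither norms,
  adjoints, orthogonal complements of complex subspaces, nor real functions of an operator.\<close>


subsection \<open>Moore-Penrose inverse\<close>

text \<open>\<open>A\<^sup>+\<close> has domain \<open>ran A + (ran A)\<^sup>\<bottom>\<close>: if \<open>y = A x + r\<close> with \<open>x \<in> (ker A)\<^sup>\<bottom>\<close> and
  \<open>r \<in> (ran A)\<^sup>\<bottom>\<close>, then \<open>A\<^sup>+ y = x\<close>. Thus \<open>A\<^sup>+\<close> is the linear extension of the inverse of \<open>A\<close>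
  restricted to \<open>(ker A)\<^sup>\<bottom>\<close> that vanishes on \<open>(ran A)\<^sup>\<bottom>\<close>. No closed range is assumed; the value
  outside the domain is unspecified.\<close>

definition moore_penrose ::
  "('x::{real_inner,complete_space} \<Rightarrow> 'y::{real_inner,complete_space}) \<Rightarrow> 'y \<Rightarrow> 'x" where
  "moore_penrose A y = (THE x. x \<in> {u. A u = 0}\<^sup>\<bottom> \<and> y - A x \<in> (range A)\<^sup>\<bottom>)"

definition ker_proj ::
  "('x::{real_inner,complete_space} \<Rightarrow> 'y::{real_inner,complete_space}) \<Rightarrow> 'x \<Rightarrow> 'x" where
  "ker_proj A x = x - moore_penrose A (A x)"


subsection \<open>Layered feed forward networks and null space networks\<close>

definition affine_map_on :: "'a::real_vector set \<Rightarrow> ('a \<Rightarrow> 'b::real_vector) \<Rightarrow> bool" where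
  "affine_map_on S W \<longleftrightarrow>
     (\<forall>x\<in>S. \<forall>y\<in>S. \<forall>t::real. W ((1 - t) *\<^sub>R x + t *\<^sub>R y) = (1 - t) *\<^sub>R W x + t *\<^sub>R W y)"

definition network_layer ::
  "'a::real_normed_vector set \<Rightarrow> 'b::real_normed_vector set \<Rightarrow> ('a \<Rightarrow> 'b) \<Rightarrow> bool" where
  "network_layer S T f \<longleftrightarrow> (\<exists>W \<sigma>. f = \<sigma> \<circ> W \<and>
     affine_map_on S W \<and> continuous_on S W \<and> W ` S \<subseteq> T \<and>
     continuous_on T \<sigma> \<and> \<sigma> ` T \<subseteq> T)"

text \<open>The number of layers is arbitrary, so the hidden Hilbert spaces \<open>X\<^sub>1, \<dots>, X\<^bsub>L-1\<^esub>\<close> cannot all be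
  types of their own. They are closed subspaces of one ambient Hilbert space \<open>'h\<close>. Any finite list of
  Hilbert spaces embeds isometrically into its orthogonal direct sum, so nothing is lost as
  long as \<open>'h\<close> is arbitrary. \<open>hidden_layers H f\<close>: \<open>f\<close> is a composition of at least one layer,
  the last of which ends in \<open>H\<close>.\<close>

inductive hidden_layers ::
  "'h::{real_inner,complete_space} set \<Rightarrow> ('x::{real_inner,complete_space} \<Rightarrow> 'h) \<Rightarrow> bool" where
  first_layer: "subspace H \<Longrightarrow> closed H \<Longrightarrow> network_layer UNIV H f \<Longrightarrow> hidden_layers H f"
| add_layer: "hidden_layers H f \<Longrightarrow> subspace H' \<Longrightarrow> closed H' \<Longrightarrow> network_layer H H' f' \<Longrightarrow>
    hidden_layers H' (f' \<circ> f)"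

definition layered_network :: "'h::{real_inner,complete_space} itself \<Rightarrow>
    ('x::{real_inner,complete_space} \<Rightarrow> 'z::{real_inner,complete_space}) \<Rightarrow> bool" where
  "layered_network _ F \<longleftrightarrow> network_layer UNIV UNIV F \<or>
     (\<exists>(H :: 'h set) f f'. hidden_layers H f \<and> network_layer H UNIV f' \<and> F = f' \<circ> f)"

definition null_space_net ::
  "('x::{real_inner,complete_space} \<Rightarrow> 'y::{real_inner,complete_space}) \<Rightarrow> ('x \<Rightarrow> 'x) \<Rightarrow> 'x \<Rightarrow> 'x" where
  "null_space_net A F x = x + ker_proj A (F x)"


subsection \<open>Functional calculus of a bounded self-adjoint operator\<close>

definition selfadjoint_op :: "('x::{real_inner,complete_space} \<Rightarrow> 'x) \<Rightarrow> bool" where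
  "selfadjoint_op T \<longleftrightarrow> bounded_linear T \<and> (\<forall>x y. T x \<bullet> y = x \<bullet> T y)"

definition projection_valued_measure ::
  "(real set \<Rightarrow> 'x::{real_inner,complete_space} \<Rightarrow> 'x) \<Rightarrow> bool" where
  "projection_valued_measure E \<longleftrightarrow>
     (\<forall>B\<in>sets borel. selfadjoint_op (E B) \<and> E B \<circ> E B = E B) \<and>
     E UNIV = id \<and>
     (\<forall>B :: nat \<Rightarrow> real set. range B \<subseteq> sets borel \<longrightarrow> disjoint_family B \<longrightarrow>
        (\<forall>x. (\<lambda>n. E (B n) x) sums E (\<Union>n. B n) x))"

definition spectral_distribution ::
  "(real set \<Rightarrow> 'x::{real_inner,complete_space} \<Rightarrow> 'x) \<Rightarrow> 'x \<Rightarrow> real measure" where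
  "spectral_distribution E x = measure_of UNIV (sets borel) (\<lambda>B. ennreal (x \<bullet> E B x))"

text \<open>\<open>T = \<integral>\<^sub>S t dE(t)\<close> for a compact set \<open>S\<close> containing the spectrum of \<open>T\<close>; operator equations
  between self-adjoint operators are expressed by their quadratic forms. By the spectral theorem
  such an \<open>E\<close> exists and is unique on Borel sets, so the choice made in \<open>spectral_measure\<close> only
  concerns irrelevant values \<open>E B\<close> for non-Borel \<open>B\<close>.\<close>

definition is_spectral_measure ::
  "real set \<Rightarrow> ('x::{real_inner,complete_space} \<Rightarrow> 'x) \<Rightarrow> (real set \<Rightarrow> 'x \<Rightarrow> 'x) \<Rightarrow> bool" where
  "is_spectral_measure S T E \<longleftrightarrow> projection_valued_measure E \<and> E S = id \<and>
     (\<forall>x. x \<bullet> T x = (LINT t:S|spectral_distribution E x. t))"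

definition spectral_measure ::
  "real set \<Rightarrow> ('x::{real_inner,complete_space} \<Rightarrow> 'x) \<Rightarrow> real set \<Rightarrow> 'x \<Rightarrow> 'x" where
  "spectral_measure S T = (SOME E. is_spectral_measure S T E)"

text \<open>\<open>f(T) = \<integral>\<^sub>S f dE\<close> for a bounded Borel function \<open>f\<close> on \<open>S\<close>; values of \<open>f\<close> outside \<open>S\<close> do not
  matter.\<close>

definition fun_calc ::
  "real set \<Rightarrow> ('x::{real_inner,complete_space} \<Rightarrow> 'x) \<Rightarrow> (real \<Rightarrow> real) \<Rightarrow> 'x \<Rightarrow> 'x" where
  "fun_calc S T f = (THE F. selfadjoint_op F \<and>
     (\<forall>x. x \<bullet> F x = (LINT t:S|spectral_distribution (spectral_measure S T) x. f t)))"

definition normal_op ::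
  "('x::{real_inner,complete_space} \<Rightarrow> 'y::{real_inner,complete_space}) \<Rightarrow> 'x \<Rightarrow> 'x" where
  "normal_op A = adjoint A \<circ> A"

definition spec_interval ::
  "('x::{real_inner,complete_space} \<Rightarrow> 'y::{real_inner,complete_space}) \<Rightarrow> real set" where
  "spec_interval A = {0..onorm (normal_op A)}"

definition normal_calc ::
  "('x::{real_inner,complete_space} \<Rightarrow> 'y::{real_inner,complete_space}) \<Rightarrow> (real \<Rightarrow> real) \<Rightarrow> 'x \<Rightarrow> 'x" where
  "normal_calc A f = fun_calc (spec_interval A) (normal_op A) f"


subsection \<open>Regularizing filters and the regularization\<close>

definition piecewise_continuous :: "real \<Rightarrow> real \<Rightarrow> (real \<Rightarrow> real) \<Rightarrow> bool" where
  "piecewise_continuous a b f \<longleftrightarrow>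
     (\<exists>D. finite D \<and> continuous_on ({a..b} - D) f) \<and>
     (\<forall>t\<in>{a<..b}. \<exists>l. (f \<longlongrightarrow> l) (at_left t)) \<and>
     (\<forall>t\<in>{a..<b}. \<exists>l. (f \<longlongrightarrow> l) (at_right t))"

text \<open>Only \<open>g \<alpha>\<close> with \<open>\<alpha> > 0\<close>, restricted to \<open>[0, \<parallel>A\<^sup>*A\<parallel>]\<close>, is relevant.\<close>

definition regularizing_filter ::
  "('x::{real_inner,complete_space} \<Rightarrow> 'y::{real_inner,complete_space}) \<Rightarrow>
    (real \<Rightarrow> real \<Rightarrow> real) \<Rightarrow> bool" where
  "regularizing_filter A g \<longleftrightarrow>
     (\<forall>\<alpha>>0. piecewise_continuous 0 (onorm (normal_op A)) (g \<alpha>)) \<and>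
     (\<exists>C>0. \<forall>\<alpha>>0. \<forall>t\<in>spec_interval A. \<bar>t * g \<alpha> t\<bar> \<le> C) \<and>
     (\<forall>t\<in>spec_interval A. t > 0 \<longrightarrow> ((\<lambda>\<alpha>. g \<alpha> t) \<longlongrightarrow> 1 / t) (at_right 0))"

definition null_space_reg ::
  "('x::{real_inner,complete_space} \<Rightarrow> 'y::{real_inner,complete_space}) \<Rightarrow> ('x \<Rightarrow> 'x) \<Rightarrow>
    (real \<Rightarrow> real \<Rightarrow> real) \<Rightarrow> (real \<Rightarrow> 'x \<Rightarrow> 'x) \<Rightarrow> real \<Rightarrow> 'y \<Rightarrow> 'x" where
  "null_space_reg A F g Q \<alpha> = (\<lambda>z. z + Q \<alpha> (F z)) \<circ> (normal_calc A (g \<alpha>) \<circ> adjoint A)"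

end

theory Submission
  imports Defs
begin

text \<open>Write \<open>x = u + P N u\<close> with \<open>u = (A\<^sup>*A)\<^sup>\<mu> w\<close> and \<open>P\<close> the projection onto \<open>ker A\<close>, so that \<open>A x = A u\<close>.
  The functional calculus bounds \<open>z - u\<close>, where \<open>z = g\<^sub>\<alpha>(A\<^sup>*A)A\<^sup>* y\<^sup>\<delta>\<close>, by a noise term of order
  \<open>\<delta> / \<surd>\<alpha>\<close> and an approximation term of order \<open>\<alpha>\<^sup>\<mu>\<close>. The remaining error is
  \<open>(P N z - P N u) + (Q\<^sub>\<alpha> - P) N z\<close>: the first part is controlled by the Lipschitz condition, the second
  because \<open>N z\<close> stays bounded: \<open>z \<rightarrow> u\<close> and \<open>N\<close> is continuous.

  The functional calculus rests on the spectral theorem for a positive operator \<open>T\<close>. Its spectral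
  projections are the projections onto \<open>{x. \<forall>n. \<parallel>T\<^sup>n x\<parallel> \<le> r\<^sup>n \<parallel>x\<parallel>}\<close>. They define Stieltjes measures, from
  which the projections of arbitrary Borel sets are obtained by a Dynkin argument.\<close>

subsection \<open>Hilbert space preliminaries\<close>

text \<open>\<open>normal_calc\<close> rests on a chosen \<open>spectral_measure\<close> and a
  definite description, so nothing can be said about it before a spectral measure of
  \<open>normal_op A\<close> exists. This is why the spectral theorem makes up most of the
  development. The growth condition behind the spectral subspaces yields closedness, monotonicity in
  \<open>r\<close> and invariance under \<open>T\<close> with little effort. The hard fact is the
  lower bound \<open>r\<close> for the form of \<open>T\<close> on the orthogonal complement; for it
  the square root and the positive and negative parts of \<open>T - r\<close> are built. Operators
  are compared through quadratic forms, which see sums and limits but not products. Multiplicativity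
  of the calculus is therefore extended from indicators in two rounds, one for each factor. The
  noise term depends on it: \<open>g(T) A\<^sup>*\<close> is estimated through the product
  \<open>g(T) T g(T)\<close>, whose symbol \<open>t g(t)\<^sup>2\<close> is at most a constant over
  \<alpha>. Its square root gives the order \<open>\<delta> / sqrt \<alpha>\<close>, and the
  prescribed \<alpha> balances this against \<open>\<alpha> powr \<mu>\<close>.\<close>

lemma convergent_dist_power_le:
  fixes u :: "nat \<Rightarrow> 'a::complete_space"
  assumes a: "a \<longlonglongrightarrow> (0::real)"
    and le: "\<And>m n. m \<le> n \<Longrightarrow> dist (u m) (u n) ^ k \<le> a m"
  shows "convergent u"
proof -
  have "Cauchy u"
  proof (rule metric_CauchyI)
    fix e :: real assume e: "e > 0"
    from LIMSEQ_D[OF a zero_less_power[OF e, of k]]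
    obtain M where M: "\<And>m. m \<ge> M \<Longrightarrow> a m < e ^ k" by force
    have less: "dist (u m) (u n) < e" if "M \<le> m" "m \<le> n" for m n
      using le[OF that(2)] M[OF that(1)] e by (meson le_less_trans less_imp_le power_less_imp_less_base)
    show "\<exists>M. \<forall>m\<ge>M. \<forall>n\<ge>M. dist (u m) (u n) < e"
      by (metis dist_commute less nat_le_linear)
  qed
  then show ?thesis by (rule Cauchy_convergent)
qed

text \<open>For small \<open>t\<close> of sign opposite to \<open>b\<close> the linear term wins.
  This is the first-order condition at the minimiser in \<open>riesz_subspace\<close>.\<close>

lemma quadratic_nonneg_imp_linear_zero:
  fixes a b :: real
  assumes "\<And>t. 0 \<le> t\<^sup>2 * a + 2 * t * b"
  shows "b = 0"
proof (rule ccontr)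
  assume b: "b \<noteq> 0"
  define s where "s = inverse (\<bar>a\<bar> + 1)"
  have s: "s > 0" "s * \<bar>a\<bar> < 1" by (simp_all add: s_def field_simps)
  have sa: "s * a \<le> s * \<bar>a\<bar>" using s by (intro mult_left_mono) auto
  have "s * b\<^sup>2 * (s * a - 2) < 0" using s sa b by (intro mult_pos_neg mult_pos_pos) (simp, simp, linarith)
  moreover have "(- (s * b))\<^sup>2 * a + 2 * (- (s * b)) * b = s * b\<^sup>2 * (s * a - 2)"
    by (simp add: power2_eq_square algebra_simps)
  ultimately show False using assms[of "- (s * b)"] by linarith
qed

text \<open>The vector is found as the minimiser of \<open>\<parallel>u\<parallel>\<^sup>2 - 2 f u\<close>. The choice \<open>M = UNIV\<close> is the Riesz
  representation theorem, \<open>f = inner x\<close> gives orthogonal projections.\<close>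

lemma riesz_subspace:
  fixes f :: "'a::{real_inner,complete_space} \<Rightarrow> real"
  assumes M: "subspace M" "closed M" and f: "bounded_linear f"
  shows "\<exists>u\<in>M. \<forall>v\<in>M. f v = u \<bullet> v"
proof -
  interpret f: bounded_linear f by fact
  define J where "J u = (norm u)\<^sup>2 - 2 * f u" for u
  obtain K where K: "\<And>u. \<bar>f u\<bar> \<le> norm u * K"
    using f.bounded by (auto simp: real_norm_def)
  have bound: "- K\<^sup>2 \<le> J u" for u
  proof -
    have "0 \<le> (norm u - K)\<^sup>2" by simp
    then show ?thesis using K[of u] by (simp add: J_def power2_diff)
  qed
  define m where "m = Inf (J ` M)"
  have bdd: "bdd_below (J ` M)" using bound by (intro bdd_belowI[of _ "- K\<^sup>2"]) auto
  have ne: "J ` M \<noteq> {}" using subspace_0[OF M(1)] by auto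
  have mle: "m \<le> J u" if "u \<in> M" for u unfolding m_def using bdd that by (intro cInf_lower) auto
  have "\<exists>u\<in>M. J u < m + inverse (real (Suc n))" for n
    using cInf_lessD[OF ne, of "m + inverse (real (Suc n))"] by (auto simp: m_def)
  then obtain u where uM: "\<And>n. u n \<in> M" and u: "\<And>n. J (u n) < m + inverse (real (Suc n))" by metis
  \<comment> \<open>A minimising sequence is Cauchy: the midpoint \<open>?w\<close> has
    \<open>J ?w\<close> at least \<open>m\<close>, and the parallelogram law turns this into a bound
    on the squared distance. Such squares are why \<open>convergent_dist_power_le\<close> carries an
    exponent.\<close>
  have "dist (u i) (u j) ^ 2 \<le> 4 * inverse (real (Suc i))" if "i \<le> j" for i j :: nat
  proof -
    let ?w = "(1/2) *\<^sub>R (u i + u j)"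
    have "?w \<in> M" using uM M(1) by (intro subspace_scale subspace_add) auto
    then have "m \<le> J ?w" by (rule mle)
    moreover have "4 * J ?w = (norm (u i + u j))\<^sup>2 - 4 * (f (u i) + f (u j))"
      unfolding J_def f.scaleR norm_scaleR power_mult_distrib f.add by (simp add: power_divide ring_distribs)
    moreover have "(dist (u i) (u j))\<^sup>2 + (norm (u i + u j))\<^sup>2 = 2 * (norm (u i))\<^sup>2 + 2 * (norm (u j))\<^sup>2"
      by (simp add: dist_norm power2_norm_eq_inner algebra_simps inner_commute)
    moreover have "inverse (real (Suc j)) \<le> inverse (real (Suc i))" using that by simp
    ultimately have "(dist (u i) (u j))\<^sup>2 \<le> 2 * J (u i) + 2 * J (u j) - 4 * m"
      and "inverse (real (Suc j)) \<le> inverse (real (Suc i))"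
      unfolding J_def[of "u i"] J_def[of "u j"] by argo+
    then show ?thesis using u[of i] u[of j] by argo
  qed
  then have "convergent u"
    by (rule convergent_dist_power_le[OF tendsto_mult_right_zero[OF LIMSEQ_inverse_real_of_nat]])
  then obtain l where l: "u \<longlonglongrightarrow> l" by (auto simp: convergent_def)
  have lM: "l \<in> M" using M(2) uM l closed_sequentially by blast
  have "(\<lambda>n. J (u n)) \<longlonglongrightarrow> J l" unfolding J_def by (intro tendsto_intros l f.tendsto)
  moreover have "(\<lambda>n. m + inverse (real (Suc n))) \<longlonglongrightarrow> m"
    using tendsto_add[OF tendsto_const[of m] LIMSEQ_inverse_real_of_nat] by simp
  ultimately have "J l \<le> m"
    using u by (intro LIMSEQ_le) (auto intro: less_imp_le)
  have "f v = l \<bullet> v" if "v \<in> M" for v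
  proof -
    have "0 \<le> t\<^sup>2 * (norm v)\<^sup>2 + 2 * t * (l \<bullet> v - f v)" for t
    proof -
      have "l + t *\<^sub>R v \<in> M" using lM that M(1) by (intro subspace_add subspace_scale)
      from mle[OF this] \<open>J l \<le> m\<close> have "J l \<le> J (l + t *\<^sub>R v)" by simp
      then show ?thesis
        unfolding J_def f.add f.scaleR power2_norm_eq_inner
        by (simp add: algebra_simps inner_commute power2_eq_square[of t])
    qed
    then show ?thesis using quadratic_nonneg_imp_linear_zero by fastforce
  qed
  with lM show ?thesis by blast
qed

text \<open>\<open>adjoint\<close> is a Hilbert choice, so its defining identity holds only once a
  candidate is known; Riesz representation on the whole space supplies it.\<close>

lemma adjoint_exists:
  fixes A :: "'a::{real_inner,complete_space} \<Rightarrow> 'b::real_inner"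
  assumes A: "bounded_linear A"
  shows "A x \<bullet> y = x \<bullet> adjoint A y"
proof -
  have "bounded_linear (\<lambda>x. A x \<bullet> y)" for y
    using bounded_linear_compose[OF bounded_linear_inner_left A] .
  then have "\<exists>u. \<forall>x. A x \<bullet> y = u \<bullet> x" for y
    using riesz_subspace[of UNIV "\<lambda>x. A x \<bullet> y"] by simp
  then have "\<exists>h. \<forall>x y. A x \<bullet> y = x \<bullet> h y"
    by (metis inner_commute)
  then have "\<forall>x y. A x \<bullet> y = x \<bullet> adjoint A y"
    unfolding adjoint_def by (rule someI_ex)
  then show ?thesis by blast
qed

lemma bounded_linear_adjoint:
  fixes A :: "'a::{real_inner,complete_space} \<Rightarrow> 'b::real_inner"
  assumes A: "bounded_linear A"
  shows "bounded_linear (adjoint A)"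
proof -
  note adj = adjoint_exists[OF A, symmetric]
  obtain K where K: "\<And>x. norm (A x) \<le> norm x * K" "K > 0"
    using bounded_linear.pos_bounded[OF A] by auto
  show ?thesis
  proof (rule bounded_linear_intro[where K = K])
    show "adjoint A (x + y) = adjoint A x + adjoint A y" for x y
      by (rule vector_eq_ldot[THEN iffD1]) (simp add: adj inner_add_right)
    show "adjoint A (r *\<^sub>R x) = r *\<^sub>R adjoint A x" for r x
      by (rule vector_eq_ldot[THEN iffD1]) (simp add: adj)
    show "norm (adjoint A x) \<le> norm x * K" for x
    proof (cases "adjoint A x = 0")
      case False
      have "norm (adjoint A x) * norm (adjoint A x) = A (adjoint A x) \<bullet> x"
        by (simp add: adjoint_exists[OF A] flip: power2_eq_square power2_norm_eq_inner)
      also have "\<dots> \<le> norm (A (adjoint A x)) * norm x" by (rule norm_cauchy_schwarz)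
      also have "\<dots> \<le> norm (adjoint A x) * K * norm x" using K by (intro mult_right_mono) auto
      finally show ?thesis using False by (simp add: mult_ac)
    qed (use K in simp)
  qed
qed

section \<open>Self-adjoint operators and their quadratic forms\<close>

lemma selfadjoint_opI:
  "bounded_linear T \<Longrightarrow> (\<And>x y. T x \<bullet> y = x \<bullet> T y) \<Longrightarrow> selfadjoint_op T"
  by (simp add: selfadjoint_op_def)

lemma selfadjoint_opD:
  assumes "selfadjoint_op T"
  shows "bounded_linear T" "T x \<bullet> y = x \<bullet> T y"
  using assms by (auto simp: selfadjoint_op_def)

lemma selfadjoint_op_linear_comb:
  assumes "selfadjoint_op F" "selfadjoint_op G"
  shows "selfadjoint_op (\<lambda>x. a *\<^sub>R F x + b *\<^sub>R G x)"
  using assms unfolding selfadjoint_op_def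
  by (auto intro!: bounded_linear_intros simp: inner_add_left inner_add_right
      intro: bounded_linear_add bounded_linear_const_scaleR)

lemma selfadjoint_op_id: "selfadjoint_op (\<lambda>x. x)"
  by (intro selfadjoint_opI bounded_linear_ident refl)

lemma selfadjoint_op_square:
  "selfadjoint_op T \<Longrightarrow> selfadjoint_op (\<lambda>x. T (T x))"
  by (simp add: selfadjoint_op_def bounded_linear_compose)

text \<open>Polarisation. Over the reals it relies on symmetry: a skew operator has zero form
  without being zero.\<close>

lemma selfadjoint_op_eqI:
  assumes F: "selfadjoint_op F" and G: "selfadjoint_op G" and eq: "\<And>x. x \<bullet> F x = x \<bullet> G x"
  shows "F = G"
proof
  fix x
  have "x \<bullet> F y = x \<bullet> G y" for x y
  proof -
    interpret F: bounded_linear F using F by (rule selfadjoint_opD)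
    interpret G: bounded_linear G using G by (rule selfadjoint_opD)
    have "y \<bullet> F x = x \<bullet> F y" "y \<bullet> G x = x \<bullet> G y"
      using selfadjoint_opD(2)[OF F, of y x] selfadjoint_opD(2)[OF G, of y x] by (simp_all add: inner_commute)
    then show ?thesis
      using eq[of "x + y"] eq[of x] eq[of y]
      by (simp add: F.add G.add inner_add_left inner_add_right)
  qed
  then show "F x = G x" using vector_eq_ldot by blast
qed

lemma positive_op_cauchy_schwarz:
  assumes P: "selfadjoint_op P" and pos: "\<And>x. 0 \<le> x \<bullet> P x"
  shows "(x \<bullet> P y)\<^sup>2 \<le> (x \<bullet> P x) * (y \<bullet> P y)"
proof -
  interpret P: bounded_linear P using P by (rule selfadjoint_opD)
  have sym: "y \<bullet> P x = x \<bullet> P y" for x y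
    using selfadjoint_opD(2)[OF P, of y x] by (simp add: inner_commute)
  have q: "0 \<le> x \<bullet> P x + 2 * t * (x \<bullet> P y) + t\<^sup>2 * (y \<bullet> P y)" for t
    using pos[of "x + t *\<^sub>R y"] sym[of y x]
    by (simp add: P.add P.scaleR inner_add_left inner_add_right algebra_simps power2_eq_square)
  show ?thesis
  proof (cases "y \<bullet> P y = 0")
    case True
    have "x \<bullet> P y = 0"
    proof (rule ccontr)
      assume "x \<bullet> P y \<noteq> 0"
      \<comment> \<open>In the degenerate case the quadratic is affine in \<open>t\<close>, and this
        \<open>t\<close> gives it the value -1.\<close>
      then show False using q[of "- (x \<bullet> P x + 1) / (2 * (x \<bullet> P y))"] True
        by (simp add: field_simps)
    qed
    then show ?thesis using True by simp
  next
    case False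
    then have "y \<bullet> P y > 0" using pos[of y] by simp
    \<comment> \<open>The vertex of the parabola.\<close>
    then show ?thesis using q[of "- (x \<bullet> P y) / (y \<bullet> P y)"]
      by (simp add: field_simps power2_eq_square)
  qed
qed

text \<open>Cauchy-Schwarz for the form of \<open>P\<close>, applied to \<open>P x\<close> and
  \<open>x\<close>. The form bound is asked at these two vectors only, because
  \<open>spec_space_lower\<close> has it just on an invariant subspace.\<close>

lemma positive_op_norm_le_at:
  assumes P: "selfadjoint_op P" and pos: "\<And>x. 0 \<le> x \<bullet> P x"
    and 1: "x \<bullet> P x \<le> c * (norm x)\<^sup>2" and 2: "P x \<bullet> P (P x) \<le> c * (norm (P x))\<^sup>2"
  shows "norm (P x) \<le> c * norm x"
proof (cases "P x = 0 \<or> x = 0")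
  case True
  then show ?thesis
  proof
    assume "P x = 0"
    show ?thesis
    proof (cases "x = 0")
      case False
      then have "c \<ge> 0" using order_trans[OF pos[of x] 1] by (simp add: zero_le_mult_iff)
      then show ?thesis using \<open>P x = 0\<close> by simp
    next
      case True
      then show ?thesis using \<open>P x = 0\<close> by simp
    qed
  next
    assume "x = 0"
    then show ?thesis
      using linear_0[OF bounded_linear.linear[OF selfadjoint_opD(1)[OF P]]] by simp
  qed
next
  case False
  then have c: "c \<ge> 0" using order_trans[OF pos[of x] 1] by (simp add: zero_le_mult_iff)
  have "(norm (P x))\<^sup>2 * (norm (P x))\<^sup>2 = (P x \<bullet> P x)\<^sup>2"
    by (simp only: power2_norm_eq_inner power2_eq_square[of "P x \<bullet> P x"])
  also have "\<dots> \<le> (P x \<bullet> P (P x)) * (x \<bullet> P x)" by (rule positive_op_cauchy_schwarz[OF P pos])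
  also have "\<dots> \<le> (c * (norm (P x))\<^sup>2) * (c * (norm x)\<^sup>2)"
    using 1 2 pos c by (intro mult_mono) auto
  also have "\<dots> = (norm (P x))\<^sup>2 * (c * norm x)\<^sup>2" by (simp add: power2_eq_square)
  finally have "(norm (P x))\<^sup>2 \<le> (c * norm x)\<^sup>2"
    using False by (simp only: mult_le_cancel_left_pos zero_less_power zero_less_norm_iff de_Morgan_disj
        simp_thms)
  then show ?thesis by (rule power2_le_imp_le) (use c in simp)
qed

lemma selfadjoint_op_norm_le:
  assumes F: "selfadjoint_op F" and le: "\<And>x. \<bar>x \<bullet> F x\<bar> \<le> c * (norm x)\<^sup>2"
  shows "norm (F x) \<le> c * norm x"
proof (cases "x = 0 \<or> F x = 0")
  case True
  interpret F: bounded_linear F using F by (rule selfadjoint_opD)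
  show ?thesis
  proof (cases "x = 0")
    case False
    have "0 \<le> c * (norm x)\<^sup>2" using le[of x] by linarith
    then have "0 \<le> c" using False by (simp add: zero_le_mult_iff)
    then show ?thesis using True False by simp
  qed (simp add: F.zero)
next
  case False
  interpret F: bounded_linear F using F by (rule selfadjoint_opD)
  \<comment> \<open>The direction of \<open>F x\<close> scaled to the length of \<open>x\<close>: it
    makes \<open>y \<bullet> F x\<close> equal to \<open>norm x * norm (F x)\<close>, which
    polarisation then bounds.\<close>
  define y where "y = (norm x / norm (F x)) *\<^sub>R F x"
  have ny: "norm y = norm x" using False by (simp add: y_def)
  have yF: "y \<bullet> F x = norm x * norm (F x)"
    using False by (simp add: y_def flip: power2_norm_eq_inner) (simp add: power2_eq_square)
  have xF: "x \<bullet> F y = y \<bullet> F x" using selfadjoint_opD(2)[OF F, of x y] by (simp add: inner_commute)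
  have "4 * (y \<bullet> F x) = (x + y) \<bullet> F (x + y) - (x - y) \<bullet> F (x - y)"
    by (simp add: F.add F.diff inner_add_left inner_add_right inner_diff_left inner_diff_right xF)
  also have "\<dots> \<le> c * (norm (x + y))\<^sup>2 + c * (norm (x - y))\<^sup>2"
    using le[of "x + y"] le[of "x - y"] by linarith
  also have "\<dots> = 4 * (c * (norm x)\<^sup>2)"
  proof -
    have "(norm (x + y))\<^sup>2 + (norm (x - y))\<^sup>2 = 2 * (norm x)\<^sup>2 + 2 * (norm y)\<^sup>2"
      by (simp add: power2_norm_eq_inner algebra_simps inner_commute)
    then show ?thesis by (simp add: ny flip: distrib_left)
  qed
  finally have "norm x * norm (F x) \<le> norm x * (c * norm x)"
    by (simp add: yF power2_eq_square mult_ac)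
  then show ?thesis using False by simp
qed

section \<open>Orthogonal projections\<close>

definition orth_proj :: "('a::{real_inner,complete_space} \<Rightarrow> 'a) \<Rightarrow> bool" where
  "orth_proj P \<longleftrightarrow> selfadjoint_op P \<and> P \<circ> P = P"

lemma orth_projD:
  assumes "orth_proj P"
  shows "selfadjoint_op P" "bounded_linear P" "P x \<bullet> y = x \<bullet> P y" "P (P x) = P x"
    "x \<bullet> P x = (norm (P x))\<^sup>2" "norm (P x) \<le> norm x"
proof -
  show s: "selfadjoint_op P" and "bounded_linear P" and sym: "P x \<bullet> y = x \<bullet> P y" for x y
    using assms by (auto simp: orth_proj_def selfadjoint_op_def)
  show idem: "P (P x) = P x" for x using assms by (auto simp: orth_proj_def o_def dest: fun_cong)
  show eq: "x \<bullet> P x = (norm (P x))\<^sup>2" for x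
    using sym[of x "P x"] idem[of x] by (simp add: power2_norm_eq_inner)
  have "(norm (P x))\<^sup>2 \<le> norm x * norm (P x)" using norm_cauchy_schwarz[of x "P x"] eq[of x] by simp
  then show "norm (P x) \<le> norm x"
    by (cases "P x = 0") (auto simp: power2_eq_square)
qed

lemma orth_projI: "selfadjoint_op P \<Longrightarrow> (\<And>x. P (P x) = P x) \<Longrightarrow> orth_proj P"
  by (simp add: orth_proj_def fun_eq_iff)

lemma orth_proj_eqI: "orth_proj P \<Longrightarrow> orth_proj Q \<Longrightarrow> (\<And>x. x \<bullet> P x = x \<bullet> Q x) \<Longrightarrow> P = Q"
  using orth_projD(1) selfadjoint_op_eqI by blast

lemma orth_proj_exists:
  fixes M :: "'a::{real_inner,complete_space} set"
  assumes M: "subspace M" "closed M"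
  shows "\<exists>P. orth_proj P \<and> range P = M \<and> (\<forall>x. \<forall>v\<in>M. (x - P x) \<bullet> v = 0)"
proof -
  have "\<exists>u\<in>M. \<forall>v\<in>M. x \<bullet> v = u \<bullet> v" for x
    using riesz_subspace[OF M bounded_linear_inner_right] .
  then obtain P where PM: "\<And>x. P x \<in> M" and P: "\<And>x v. v \<in> M \<Longrightarrow> x \<bullet> v = P x \<bullet> v" by metis
  have uniq: "u = v" if "u \<in> M" "v \<in> M" "\<And>w. w \<in> M \<Longrightarrow> u \<bullet> w = v \<bullet> w" for u v
  proof -
    have "u - v \<in> M" using that M(1) by (intro subspace_diff)
    then have "(u - v) \<bullet> (u - v) = 0" using that(3) by (simp add: inner_diff_left)
    then show ?thesis by simp
  qed
  have Pid: "P v = v" if "v \<in> M" for v using that PM P by (intro uniq) (auto simp flip: P)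
  have "bounded_linear P"
  proof (rule bounded_linear_intro[where K = 1])
    show "P (x + y) = P x + P y" for x y
      using PM M(1) by (intro uniq) (auto simp: inner_add_left subspace_add simp flip: P)
    show "P (r *\<^sub>R x) = r *\<^sub>R P x" for r x
      using PM M(1) by (intro uniq) (auto simp: subspace_scale simp flip: P)
    show "norm (P x) \<le> norm x * 1" for x
    proof -
      have "norm (P x) * norm (P x) = x \<bullet> P x"
        using P[OF PM, of x] by (simp flip: power2_eq_square power2_norm_eq_inner)
      also have "\<dots> \<le> norm x * norm (P x)" by (rule norm_cauchy_schwarz)
      finally show ?thesis by (cases "P x = 0") auto
    qed
  qed
  moreover have "P x \<bullet> y = x \<bullet> P y" for x y
    using P[OF PM, of y x] P[OF PM, of x y] by (simp add: inner_commute)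
  moreover have rP: "range P = M" using PM Pid by (metis image_subset_iff rangeI subsetI subset_antisym)
  moreover have "P (P x) = P x" for x using PM Pid by simp
  ultimately have "orth_proj P" using orth_projI selfadjoint_opI by blast
  moreover have "(x - P x) \<bullet> v = 0" if "v \<in> M" for x v
    using P[OF that, of x] by (simp only: inner_diff_left)
  ultimately show ?thesis using rP by blast
qed

subsection \<open>Square roots and Jordan decomposition\<close>

text \<open>The common bound \<open>K\<close> allows operator and argument to vary together under
  merely pointwise convergence. It serves the quadratic term of \<open>sqrt_iter\<close>.\<close>

lemma tendsto_bounded_ops:
  fixes F :: "nat \<Rightarrow> 'a::real_normed_vector \<Rightarrow> 'b::real_normed_vector"
  assumes lin: "\<And>n. bounded_linear (F n)" and bd: "\<And>n x. norm (F n x) \<le> K * norm x"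
    and lim: "(\<lambda>n. F n v) \<longlonglongrightarrow> w" and u: "u \<longlonglongrightarrow> v"
  shows "(\<lambda>n. F n (u n)) \<longlonglongrightarrow> w"
proof -
  have "(\<lambda>n. norm (u n - v)) \<longlonglongrightarrow> 0" using u by (simp add: LIM_zero tendsto_norm_zero)
  then have "(\<lambda>n. K * norm (u n - v)) \<longlonglongrightarrow> 0" by (rule tendsto_mult_right_zero)
  then have "(\<lambda>n. F n (u n - v)) \<longlonglongrightarrow> 0"
    by (rule Lim_null_comparison[rotated]) (simp add: bd)
  from tendsto_add[OF this lim] show ?thesis
    by (simp add: linear_diff[OF bounded_linear.linear[OF lin]])
qed

lemma selfadjoint_op_limit:
  assumes F: "\<And>n. selfadjoint_op (F n)" and bd: "\<And>n x. norm (F n x) \<le> K * norm x"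
    and lim: "\<And>x. (\<lambda>n. F n x) \<longlonglongrightarrow> G x"
  shows "selfadjoint_op G" "norm (G x) \<le> K * norm x"
proof -
  note lin = bounded_linear.linear[OF selfadjoint_opD(1)[OF F]]
  show Gbd: "norm (G x) \<le> K * norm x" for x
    by (rule LIMSEQ_le_const2[OF tendsto_norm[OF lim]]) (use bd in blast)
  show "selfadjoint_op G"
  proof (rule selfadjoint_opI)
    show "bounded_linear G"
    proof (rule bounded_linear_intro)
      show "G (x + y) = G x + G y" for x y
        using LIMSEQ_unique[OF lim[of "x + y"]] tendsto_add[OF lim[of x] lim[of y]]
        by (simp add: linear_add[OF lin])
      show "G (r *\<^sub>R x) = r *\<^sub>R G x" for r x
        using LIMSEQ_unique[OF lim[of "r *\<^sub>R x"]] tendsto_scaleR[OF tendsto_const[of r] lim[of x]]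
        by (simp add: linear_scale[OF lin])
      show "norm (G x) \<le> norm x * K" for x using Gbd[of x] by (simp add: mult.commute)
    qed
    show "G x \<bullet> y = x \<bullet> G y" for x y
    proof -
      have "(\<lambda>n. F n x \<bullet> y) \<longlonglongrightarrow> G x \<bullet> y" by (intro tendsto_intros lim)
      moreover have "(\<lambda>n. F n x \<bullet> y) \<longlonglongrightarrow> x \<bullet> G y"
        unfolding selfadjoint_opD(2)[OF F] by (intro tendsto_intros lim)
      ultimately show ?thesis by (rule LIMSEQ_unique)
    qed
  qed
qed

text \<open>The iteration \<open>Y \<mapsto> (R + Y\<^sup>2) / 2\<close> converges to a solution of \<open>(1 - Y)\<^sup>2 = 1 - R\<close>. The scalar
  iteration with \<open>R = 1\<close> is a majorant.\<close>

primrec sqrt_iter :: "('a::real_vector \<Rightarrow> 'a) \<Rightarrow> nat \<Rightarrow> 'a \<Rightarrow> 'a" where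
  "sqrt_iter R 0 = (\<lambda>x. 0)"
| "sqrt_iter R (Suc n) = (\<lambda>x. (1/2) *\<^sub>R R x + (1/2) *\<^sub>R sqrt_iter R n (sqrt_iter R n x))"

primrec sqrt_majorant :: "nat \<Rightarrow> real" where
  "sqrt_majorant 0 = 0"
| "sqrt_majorant (Suc n) = (1 + (sqrt_majorant n)\<^sup>2) / 2"

lemma sqrt_majorant_bounds: "0 \<le> sqrt_majorant n" "sqrt_majorant n \<le> 1"
proof -
  have "0 \<le> sqrt_majorant n \<and> sqrt_majorant n \<le> 1"
    by (induction n) (auto simp: power_le_one)
  then show "0 \<le> sqrt_majorant n" "sqrt_majorant n \<le> 1" by auto
qed

lemma incseq_sqrt_majorant: "incseq sqrt_majorant"
proof (rule incseq_SucI)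
  fix n
  have "0 \<le> (1 - sqrt_majorant n)\<^sup>2" by simp
  then show "sqrt_majorant n \<le> sqrt_majorant (Suc n)" by (simp add: power2_eq_square algebra_simps)
qed

text \<open>With \<open>R = 1 - C\<close>, a contraction because the form of \<open>C\<close> lies
  between 0 and 1, the increments of the iteration are dominated by those of the bounded scalar
  majorant. The limit satisfies \<open>Z = (R + Z\<^sup>2) / 2\<close>, so \<open>S = 1 - Z\<close>
  squares to \<open>C\<close>. Each iterate is a polynomial in \<open>R\<close>, whence the
  commutation clause.\<close>

lemma positive_op_sqrt:
  fixes C :: "'a::{real_inner,complete_space} \<Rightarrow> 'a"
  assumes C: "selfadjoint_op C" and pos: "\<And>x. 0 \<le> x \<bullet> C x" and le: "\<And>x. x \<bullet> C x \<le> (norm x)\<^sup>2"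
  shows "\<exists>S. selfadjoint_op S \<and> (\<forall>x. 0 \<le> x \<bullet> S x) \<and> (\<forall>x. S (S x) = C x) \<and>
    (\<forall>K. bounded_linear K \<longrightarrow> (\<forall>x. K (C x) = C (K x)) \<longrightarrow> (\<forall>x. K (S x) = S (K x)))"
proof -
  define R where "R x = 1 *\<^sub>R x + (-1) *\<^sub>R C x" for x
  have R: "selfadjoint_op R"
    unfolding R_def by (intro selfadjoint_op_linear_comb selfadjoint_op_id C)
  have R1: "norm (R x) \<le> norm x" for x
  proof -
    have "\<bar>y \<bullet> R y\<bar> \<le> 1 * (norm y)\<^sup>2" for y
      using pos[of y] le[of y] by (simp add: R_def inner_diff_right power2_norm_eq_inner abs_le_iff)
    from selfadjoint_op_norm_le[OF R this] show ?thesis by simp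
  qed
  let ?Y = "sqrt_iter R" and ?y = sqrt_majorant
  have Y: "selfadjoint_op (?Y n)" for n
  proof (induction n)
    case 0
    show ?case by (simp add: selfadjoint_op_def)
  next
    case (Suc n)
    then show ?case by (simp only: sqrt_iter.simps selfadjoint_op_linear_comb[OF R selfadjoint_op_square])
  qed
  note linY = bounded_linear.linear[OF selfadjoint_opD(1)[OF Y]]
  have Ybd: "norm (?Y n x) \<le> ?y n * norm x" for n x
  proof (induction n arbitrary: x)
    case (Suc n)
    have "norm (?Y n (?Y n x)) \<le> ?y n * norm (?Y n x)" by (rule Suc)
    also have "\<dots> \<le> ?y n * (?y n * norm x)" using Suc sqrt_majorant_bounds by (intro mult_left_mono)
    finally have "norm (?Y (Suc n) x) \<le> (1/2) * norm x + (1/2) * (?y n * (?y n * norm x))"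
      unfolding sqrt_iter.simps using R1[of x] by (intro order_trans[OF norm_triangle_ineq]) simp
    then show ?case by (simp add: power2_eq_square field_simps)
  qed simp
  have Ystep: "norm (?Y (Suc n) x - ?Y n x) \<le> (?y (Suc n) - ?y n) * norm x" for n x
  proof (induction n arbitrary: x)
    case 0
    then show ?case using R1[of x] by simp
  next
    case (Suc n)
    let ?D = "\<lambda>x. ?Y (Suc n) x - ?Y n x"
    let ?d = "?y (Suc n) - ?y n"
    have d: "0 \<le> ?d" using incseq_sqrt_majorant by (simp add: incseq_SucD del: sqrt_majorant.simps)
    \<comment> \<open>Writing \<open>Y'\<close> for the next iterate,
      \<open>Y'Y' - YY = Y'(Y' - Y) + (Y' - Y)Y\<close>. The order of the factors is kept, so the
      iterates are never commuted, and the majorant obeys the same identity.\<close>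
    have eq: "?Y (Suc (Suc n)) x - ?Y (Suc n) x = (1/2) *\<^sub>R (?Y (Suc n) (?D x) + ?D (?Y n x))"
      unfolding linear_diff[OF linY] sqrt_iter.simps(2)[of R "Suc n"] sqrt_iter.simps(2)[of R n, THEN fun_cong, of x]
      by (simp only: sqrt_iter.simps(2)[of R n, THEN fun_cong, of x, symmetric]) (simp add: algebra_simps)
    have "norm (?Y (Suc n) (?D x)) \<le> ?y (Suc n) * (?d * norm x)"
      using Ybd[of "Suc n" "?D x"] mult_left_mono[OF Suc[of x] sqrt_majorant_bounds(1)[of "Suc n"]] by linarith
    moreover have "norm (?D (?Y n x)) \<le> ?d * (?y n * norm x)"
      using Suc[of "?Y n x"] mult_left_mono[OF Ybd[of n x] d] by linarith
    ultimately have "norm (?Y (Suc (Suc n)) x - ?Y (Suc n) x)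
      \<le> (1/2) * (?y (Suc n) * (?d * norm x) + ?d * (?y n * norm x))"
      unfolding eq norm_scaleR using norm_triangle_ineq[of "?Y (Suc n) (?D x)" "?D (?Y n x)"] by simp
    also have "\<dots> = (?y (Suc (Suc n)) - ?y (Suc n)) * norm x"
      unfolding sqrt_majorant.simps(2)[of "Suc n"] sqrt_majorant.simps(2)[of n, THEN arg_cong, of "\<lambda>t. _ - t"]
      by (simp add: power2_eq_square field_simps)
    finally show ?case .
  qed
  have Ydist: "norm (?Y n x - ?Y m x) \<le> (?y n - ?y m) * norm x" if "m \<le> n" for m n x
    using that
  proof (induction rule: dec_induct)
    case (step n)
    show ?case
      using norm_triangle_ineq[of "?Y (Suc n) x - ?Y n x" "?Y n x - ?Y m x"] Ystep[of n x] step.IH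
      by (simp add: algebra_simps del: sqrt_iter.simps sqrt_majorant.simps)
  qed simp
  obtain L where L: "?y \<longlonglongrightarrow> L" "\<And>n. ?y n \<le> L"
    using incseq_convergent[OF incseq_sqrt_majorant, of 1] sqrt_majorant_bounds(2) by blast
  define Z where "Z x = lim (\<lambda>n. ?Y n x)" for x
  have "convergent (\<lambda>n. ?Y n x)" for x
  proof (rule convergent_dist_power_le[where k = 1])
    show "(\<lambda>n. (L - ?y n) * norm x) \<longlonglongrightarrow> 0"
      using tendsto_mult[OF tendsto_diff[OF tendsto_const[of L] L(1)] tendsto_const[of "norm x"]] by simp
    show "dist (?Y m x) (?Y n x) ^ 1 \<le> (L - ?y m) * norm x" if "m \<le> n" for m n
    proof -
      have "norm (?Y n x - ?Y m x) \<le> (L - ?y m) * norm x"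
        using Ydist[OF that, of x] mult_right_mono[OF diff_right_mono[OF L(2)[of n], of "?y m"] norm_ge_zero[of x]]
        by linarith
      then show ?thesis by (simp only: dist_norm norm_minus_commute power_one_right)
    qed
  qed
  then have Z: "(\<lambda>n. ?Y n x) \<longlonglongrightarrow> Z x" for x by (simp only: convergent_LIMSEQ_iff Z_def)
  have Ybd1: "norm (?Y n x) \<le> 1 * norm x" for n x
    using Ybd[of n x] mult_right_mono[OF sqrt_majorant_bounds(2)[of n], of "norm x"] by simp
  note Zprops = selfadjoint_op_limit[OF Y Ybd1 Z]
  have Zeq: "Z x = (1/2) *\<^sub>R R x + (1/2) *\<^sub>R Z (Z x)" for x
  proof (rule LIMSEQ_unique)
    show "(\<lambda>n. ?Y (Suc n) x) \<longlonglongrightarrow> Z x" using Z[of x] by (rule LIMSEQ_Suc)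
    show "(\<lambda>n. ?Y (Suc n) x) \<longlonglongrightarrow> (1/2) *\<^sub>R R x + (1/2) *\<^sub>R Z (Z x)"
      unfolding sqrt_iter.simps
      by (intro tendsto_intros tendsto_bounded_ops[OF selfadjoint_opD(1)[OF Y] Ybd1 Z Z])
  qed
  define S where "S x = 1 *\<^sub>R x + (-1) *\<^sub>R Z x" for x
  have "selfadjoint_op S"
    unfolding S_def by (intro selfadjoint_op_linear_comb selfadjoint_op_id Zprops)
  moreover have "0 \<le> x \<bullet> S x" for x
    using norm_cauchy_schwarz[of x "Z x"] mult_left_mono[OF Zprops(2)[of x], of "norm x"]
    by (simp add: S_def inner_diff_right flip: power2_norm_eq_inner) (simp add: power2_eq_square)
  moreover have "S (S x) = C x" for x
  proof -
    have "2 *\<^sub>R Z x = x - C x + Z (Z x)"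
      using arg_cong[OF Zeq[of x], of "\<lambda>v. 2 *\<^sub>R v"] by (simp add: R_def scaleR_add_right)
    then show ?thesis
      by (simp add: S_def linear_diff[OF bounded_linear.linear[OF selfadjoint_opD(1)[OF Zprops(1)]]]
          scaleR_2 algebra_simps)
  qed
  moreover have "K (S x) = S (K x)" if K: "bounded_linear K" and comm: "\<And>x. K (C x) = C (K x)" for K x
  proof -
    interpret K: bounded_linear K by fact
    have "K (?Y n x) = ?Y n (K x)" for n x
      by (induction n arbitrary: x) (simp_all add: K.zero K.add K.scaleR R_def K.diff comm)
    then have "(\<lambda>n. ?Y n (K x)) \<longlonglongrightarrow> K (Z x)" using K.tendsto[OF Z[of x]] by simp
    then have "K (Z x) = Z (K x)" using Z LIMSEQ_unique by blast
    then show ?thesis by (simp add: S_def K.diff)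
  qed
  ultimately show ?thesis by blast
qed

text \<open>The positive and negative part of \<open>B\<close> are \<open>(S + B) / 2\<close> and \<open>(S - B) / 2\<close> with \<open>S = \<surd>(B\<^sup>2)\<close>.\<close>

lemma selfadjoint_op_jordan:
  fixes B :: "'a::{real_inner,complete_space} \<Rightarrow> 'a"
  assumes B: "selfadjoint_op B"
  shows "\<exists>P N. selfadjoint_op P \<and> selfadjoint_op N \<and> (\<forall>x. P (N x) = 0) \<and>
    (\<forall>x. P x = 0 \<longrightarrow> x \<bullet> B x \<le> 0) \<and> (\<forall>x. N x = 0 \<longrightarrow> 0 \<le> x \<bullet> B x) \<and>
    (\<forall>K. bounded_linear K \<longrightarrow> (\<forall>x. K (B x) = B (K x)) \<longrightarrow> (\<forall>x. K (P x) = P (K x)))"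
proof -
  obtain b where b: "b > 0" and Bb: "\<And>x. norm (B x) \<le> norm x * b"
    using bounded_linear.pos_bounded[OF selfadjoint_opD(1)[OF B]] by auto
  interpret B: bounded_linear B using B by (rule selfadjoint_opD)
  \<comment> \<open>Division by \<open>b\<close> brings the square below the identity, as
    \<open>positive_op_sqrt\<close> demands. Hence \<open>S\<close> below is the square root of
    \<open>B\<^sup>2\<close> divided by \<open>b\<close>, and \<open>b S\<close> is the modulus of
    \<open>B\<close>.\<close>
  define D where "D x = (1 / b) *\<^sub>R B x + 0 *\<^sub>R B x" for x
  have D: "selfadjoint_op D" unfolding D_def by (intro selfadjoint_op_linear_comb B)
  have DD: "x \<bullet> D (D x) = (norm (D x))\<^sup>2" for x
    using selfadjoint_opD(2)[OF D, of x "D x"] by (simp add: power2_norm_eq_inner)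
  have "norm (D x) \<le> norm x" for x using Bb[of x] b by (simp add: D_def divide_le_eq)
  then have Dle: "x \<bullet> D (D x) \<le> (norm x)\<^sup>2" for x unfolding DD by (simp add: power_mono)
  from positive_op_sqrt[OF selfadjoint_op_square[OF D]] Dle
  obtain S where S: "selfadjoint_op S" and Spos: "\<And>x. 0 \<le> x \<bullet> S x" and SS: "\<And>x. S (S x) = D (D x)"
    and comm: "\<And>K x. bounded_linear K \<Longrightarrow> (\<And>x. K (D (D x)) = D (D (K x))) \<Longrightarrow> K (S x) = S (K x)"
    using DD by (metis zero_le_power2)
  interpret S: bounded_linear S using S by (rule selfadjoint_opD)
  have SB: "B (S x) = S (B x)" for x
    by (rule comm) (simp_all add: D_def B.scaleR B.bounded_linear_axioms)
  have BB: "B (B x) = (b * b) *\<^sub>R S (S x)" for x using b by (simp add: SS D_def B.scaleR)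
  define P where "P x = (b / 2) *\<^sub>R S x + (1 / 2) *\<^sub>R B x" for x
  define N where "N x = (b / 2) *\<^sub>R S x + (- 1 / 2) *\<^sub>R B x" for x
  have P: "selfadjoint_op P" and N: "selfadjoint_op N"
    unfolding P_def N_def by (intro selfadjoint_op_linear_comb B S)+
  \<comment> \<open>The product is a quarter of
    \<open>b\<^sup>2 S\<^sup>2 - B\<^sup>2 + b (B S - S B)\<close>, which vanishes by
    \<open>BB\<close> and \<open>SB\<close>.\<close>
  have PN: "P (N x) = 0" for x
    by (simp add: P_def N_def S.add S.scaleR B.add B.scaleR BB SB S.diff B.diff algebra_simps)
  have sum: "P x + N x = b *\<^sub>R S x" and diff: "B x = P x - N x" for x
    by (simp_all add: P_def N_def flip: scaleR_add_left)
  have commP: "K (P x) = P (K x)" if K: "bounded_linear K" and KB: "\<And>x. K (B x) = B (K x)" for K x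
  proof -
    interpret K: bounded_linear K by fact
    have "K (S x) = S (K x)" by (rule comm[OF K]) (simp add: D_def K.scaleR KB B.scaleR)
    then show ?thesis by (simp add: P_def K.add K.scaleR KB)
  qed
  have "x \<bullet> B x \<le> 0" if "P x = 0" for x
  proof -
    have "B x = - (b *\<^sub>R S x)" using sum[of x] diff[of x] that by simp
    then show ?thesis using Spos[of x] b by simp
  qed
  moreover have "0 \<le> x \<bullet> B x" if "N x = 0" for x
  proof -
    have "B x = b *\<^sub>R S x" using sum[of x] diff[of x] that by simp
    then show ?thesis using Spos[of x] b by simp
  qed
  ultimately show ?thesis using P N PN commP by blast
qed

subsection \<open>Spectral subspaces of a positive operator\<close>

locale positive_op =
  fixes T :: "'a::{real_inner,complete_space} \<Rightarrow> 'a"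
  assumes selfadjoint: "selfadjoint_op T" and nonneg: "0 \<le> x \<bullet> T x"
begin

sublocale T: bounded_linear T
  using selfadjoint by (rule selfadjoint_opD)

lemma sym: "T x \<bullet> y = x \<bullet> T y"
  using selfadjoint by (rule selfadjoint_opD)

text \<open>The range of the spectral projection of \<open>T\<close> for the interval \<open>(-\<infinity>, r]\<close>; it is trivial for
  \<open>r < 0\<close> because of \<open>n = 1\<close>.\<close>

definition spec_space :: "real \<Rightarrow> 'a set" where
  "spec_space r = {x. \<forall>n. norm ((T ^^ n) x) \<le> r ^ n * norm x}"

lemma funpow_bounded_linear: "bounded_linear (T ^^ n)"
proof (induction n)
  case 0
  show ?case by (simp add: id_def bounded_linear_ident)
next
  case (Suc n)
  then show ?case using bounded_linear_compose[OF T.bounded_linear_axioms] by (simp add: o_def)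
qed

lemma funpow_sym: "(T ^^ n) x \<bullet> y = x \<bullet> (T ^^ n) y"
  by (induction n arbitrary: x y) (simp_all add: sym funpow_swap1)

lemma norm_funpow_square_le: "(norm ((T ^^ n) x))\<^sup>2 \<le> norm x * norm ((T ^^ (2 * n)) x)"
proof -
  have "(norm ((T ^^ n) x))\<^sup>2 = x \<bullet> (T ^^ (2 * n)) x"
    by (simp add: power2_norm_eq_inner funpow_sym mult_2 funpow_add)
  then show ?thesis using norm_cauchy_schwarz[of x "(T ^^ (2 * n)) x"] by simp
qed

text \<open>By \<open>norm_funpow_square_le\<close> the sequence \<open>b n = \<parallel>T\<^sup>n x\<parallel> / (r\<^sup>n \<parallel>x\<parallel>)\<close> satisfies
  \<open>(b n)\<^sup>2 \<le> b (2 n)\<close>, so it stays below \<open>1\<close> if it is bounded.\<close>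

lemma spec_spaceI:
  assumes r: "0 \<le> r" and C: "\<And>n. norm ((T ^^ n) x) \<le> C * r ^ n"
  shows "x \<in> spec_space r"
proof -
  have "norm ((T ^^ n) x) \<le> r ^ n * norm x" for n
  proof (cases "x = 0 \<or> r ^ n = 0")
    case True
    then show ?thesis
    proof
      assume "x = 0"
      then show ?thesis by (simp add: bounded_linear.linear[OF funpow_bounded_linear, THEN linear_0])
    next
      assume "r ^ n = 0"
      with C[of n] have "norm ((T ^^ n) x) \<le> 0" by (simp only: mult_zero_right)
      with \<open>r ^ n = 0\<close> show ?thesis by simp
    qed
  next
    case False
    define b where "b k = norm ((T ^^ k) x) / (r ^ k * norm x)" for k
    have pos: "r > 0" if "k > 0" "r ^ k \<noteq> 0" for k using r that by (cases "r = 0") auto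
    have npos: "norm x > 0" using False by simp
    show ?thesis
    proof (cases "n = 0")
      case n: False
      then have r0: "r > 0" using pos False by auto
      have b2: "(b k)\<^sup>2 \<le> b (2 * k)" for k
      proof -
        have "(b k)\<^sup>2 = (norm ((T ^^ k) x))\<^sup>2 / (r ^ (2 * k) * (norm x * norm x))"
          by (simp add: b_def power_divide power_mult_distrib power2_eq_square mult_2_right power_add mult_ac)
        also have "\<dots> \<le> (norm x * norm ((T ^^ (2 * k)) x)) / (r ^ (2 * k) * (norm x * norm x))"
          using r0 by (intro divide_right_mono norm_funpow_square_le) auto
        also have "\<dots> = b (2 * k)" using npos r0 by (simp add: b_def field_simps)
        finally show ?thesis .
      qed
      have iter: "b n ^ (2 ^ j) \<le> b (2 ^ j * n)" for j
      proof (induction j)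
        case (Suc j)
        have "b n ^ (2 ^ Suc j) = (b n ^ (2 ^ j))\<^sup>2" by (simp add: power_mult mult.commute flip: power_mult)
        also have "\<dots> \<le> (b (2 ^ j * n))\<^sup>2"
          using Suc r0 by (intro power_mono) (auto simp: b_def)
        also have "\<dots> \<le> b (2 * (2 ^ j * n))" by (rule b2)
        finally show ?case by (simp add: mult.assoc)
      qed simp
      have bC: "b k \<le> C / norm x" for k
        using C[of k] npos r0 by (simp add: b_def field_simps)
      have "b n \<le> 1"
      proof (rule ccontr)
        assume "\<not> b n \<le> 1"
        then obtain N where N: "C / norm x < b n ^ N" using real_arch_pow[of "b n" "C / norm x"] by auto
        have "b n ^ N \<le> b n ^ (2 ^ N)"
          using \<open>\<not> b n \<le> 1\<close> by (intro power_increasing) (auto intro: less_imp_le less_exp)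
        then show False using N iter[of N] bC[of "2 ^ N * n"] by linarith
      qed
      then show ?thesis using npos r0 by (simp add: b_def field_simps)
    qed simp
  qed
  then show ?thesis by (simp add: spec_space_def)
qed

lemma spec_spaceD: "x \<in> spec_space r \<Longrightarrow> norm ((T ^^ n) x) \<le> r ^ n * norm x"
  by (simp add: spec_space_def)

lemma spec_space_neg: "r < 0 \<Longrightarrow> spec_space r = {0}"
proof -
  assume r: "r < 0"
  have "x = 0" if "x \<in> spec_space r" for x
  proof (rule ccontr)
    assume "x \<noteq> 0"
    then have "r * norm x < 0" using r by (simp add: mult_neg_pos)
    then show False using spec_spaceD[OF that, of 1] norm_ge_zero[of "T x"] by simp
  qed
  then show ?thesis by (auto simp: spec_space_def bounded_linear.linear[OF funpow_bounded_linear, THEN linear_0])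
qed

text \<open>A sum inherits the growth bound only with the constant \<open>norm x + norm y\<close>;
  \<open>spec_spaceI\<close> sharpens this to the norm of the sum.\<close>

lemma subspace_spec_space: "subspace (spec_space r)"
proof (cases "r < 0")
  case False
  then have r: "0 \<le> r" by simp
  show ?thesis
  proof (rule subspaceI)
    show "0 \<in> spec_space r"
      by (simp add: spec_space_def bounded_linear.linear[OF funpow_bounded_linear, THEN linear_0])
    show "x + y \<in> spec_space r" if "x \<in> spec_space r" "y \<in> spec_space r" for x y
    proof (rule spec_spaceI[OF r])
      show "norm ((T ^^ n) (x + y)) \<le> (norm x + norm y) * r ^ n" for n
        using norm_triangle_ineq[of "(T ^^ n) x" "(T ^^ n) y"] spec_spaceD[OF that(1), of n]
          spec_spaceD[OF that(2), of n]
        by (simp add: bounded_linear.linear[OF funpow_bounded_linear, THEN linear_add] algebra_simps)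
    qed
    show "c *\<^sub>R x \<in> spec_space r" if "x \<in> spec_space r" for c x
    proof (rule spec_spaceI[OF r])
      show "norm ((T ^^ n) (c *\<^sub>R x)) \<le> (\<bar>c\<bar> * norm x) * r ^ n" for n
        using mult_left_mono[OF spec_spaceD[OF that, of n], of "\<bar>c\<bar>"]
        by (simp add: bounded_linear.linear[OF funpow_bounded_linear, THEN linear_scale] mult_ac)
    qed
  qed
qed (simp add: spec_space_neg)

lemma closed_spec_space: "closed (spec_space r)"
proof -
  have "spec_space r = (\<Inter>n. {x. norm ((T ^^ n) x) \<le> r ^ n * norm x})"
    by (auto simp: spec_space_def)
  moreover have "closed {x. norm ((T ^^ n) x) \<le> r ^ n * norm x}" for n
    by (intro closed_Collect_le continuous_intros bounded_linear.continuous_on[OF funpow_bounded_linear])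
  ultimately show ?thesis by auto
qed

lemma spec_space_invariant:
  assumes "x \<in> spec_space r" shows "T x \<in> spec_space r"
proof (cases "r < 0")
  case True
  then show ?thesis using assms by (simp add: spec_space_neg T.zero)
next
  case False
  then have r: "0 \<le> r" by simp
  then show ?thesis
  proof (rule spec_spaceI)
    show "norm ((T ^^ n) (T x)) \<le> (r * norm x) * r ^ n" for n
      using spec_spaceD[OF assms, of "Suc n"] by (simp add: funpow_swap1 mult_ac)
  qed
qed

lemma spec_space_mono:
  assumes "r \<le> s" shows "spec_space r \<subseteq> spec_space s"
proof (cases "r < 0")
  case True
  then show ?thesis using subspace_0[OF subspace_spec_space] by (simp add: spec_space_neg)
next
  case False
  show ?thesis
  proof
    fix x assume x: "x \<in> spec_space r"
    show "x \<in> spec_space s"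
      unfolding spec_space_def
      using order_trans[OF spec_spaceD[OF x] mult_right_mono[OF power_mono[OF assms]]] False by auto
  qed
qed

lemma spec_space_right_continuous:
  assumes "\<And>s. s > r \<Longrightarrow> x \<in> spec_space s" shows "x \<in> spec_space r"
proof -
  have "norm ((T ^^ n) x) \<le> r ^ n * norm x" for n
  proof (rule tendsto_le)
    show "((\<lambda>s. s ^ n * norm x) \<longlongrightarrow> r ^ n * norm x) (at_right r)" by (intro tendsto_intros)
    show "\<forall>\<^sub>F s in at_right r. norm ((T ^^ n) x) \<le> s ^ n * norm x"
      using assms by (auto intro!: spec_spaceD eventually_at_right_less[THEN eventually_mono])
  qed auto
  then show ?thesis by (simp add: spec_space_def)
qed

lemma spec_space_UNIV: "onorm T \<le> r \<Longrightarrow> spec_space r = UNIV"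
proof -
  assume r: "onorm T \<le> r"
  then have r0: "0 \<le> r" using onorm_pos_le[OF T.bounded_linear_axioms] by linarith
  have "norm ((T ^^ n) x) \<le> r ^ n * norm x" for n x
  proof (induction n)
    case (Suc n)
    have "norm (T ((T ^^ n) x)) \<le> onorm T * norm ((T ^^ n) x)" by (rule onorm[OF T.bounded_linear_axioms])
    also have "\<dots> \<le> r * (r ^ n * norm x)" using Suc r r0 by (intro mult_mono) auto
    finally show ?case by simp
  qed simp
  then show ?thesis by (auto simp: spec_space_def)
qed

lemma spec_space_upper:
  assumes x: "x \<in> spec_space r" shows "x \<bullet> T x \<le> r * (norm x)\<^sup>2"
  using norm_cauchy_schwarz[of x "T x"] mult_left_mono[OF spec_spaceD[OF x, of 1], of "norm x"]
  by (simp add: power2_eq_square mult_ac)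

text \<open>Let \<open>P\<close> and \<open>N\<close> be the positive and negative part of
  \<open>B = T - r\<close>. On the kernel of \<open>P\<close> the form of \<open>T\<close> is at
  most \<open>r\<close>, and this kernel is invariant under \<open>T\<close>, so powers of
  \<open>T\<close> grow at most like \<open>r ^ n\<close> there and the kernel lies in
  \<open>spec_space r\<close>. For negative \<open>r\<close> the claim is just positivity of
  \<open>T\<close>.\<close>

lemma spec_space_lower:
  assumes x: "\<And>v. v \<in> spec_space r \<Longrightarrow> x \<bullet> v = 0" shows "r * (norm x)\<^sup>2 \<le> x \<bullet> T x"
proof (cases "r < 0")
  case True
  then have "r * (norm x)\<^sup>2 \<le> 0" by (simp add: mult_nonpos_nonneg)
  then show ?thesis using nonneg[of x] by linarith
next
  case False
  define B where "B x = 1 *\<^sub>R T x + (- r) *\<^sub>R x" for x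
  have "selfadjoint_op B"
    unfolding B_def by (intro selfadjoint_op_linear_comb selfadjoint selfadjoint_op_id)
  from selfadjoint_op_jordan[OF this]
  obtain P N where P: "selfadjoint_op P" and N: "selfadjoint_op N" and PN: "\<And>x. P (N x) = 0"
    and neg: "\<And>x. P x = 0 \<Longrightarrow> x \<bullet> B x \<le> 0" and pos: "\<And>x. N x = 0 \<Longrightarrow> 0 \<le> x \<bullet> B x"
    and comm: "\<And>K x. bounded_linear K \<Longrightarrow> (\<And>x. K (B x) = B (K x)) \<Longrightarrow> K (P x) = P (K x)"
    by blast
  have PT: "P (T x) = T (P x)" for x
    by (rule comm[symmetric]) (simp_all add: T.bounded_linear_axioms B_def T.diff T.scaleR)
  have Tle: "norm (T y) \<le> r * norm y" if "P y = 0" for y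
  proof (rule positive_op_norm_le_at[OF selfadjoint nonneg])
    have *: "z \<bullet> T z \<le> r * (norm z)\<^sup>2" if "P z = 0" for z
      using neg[OF that] by (simp add: B_def inner_diff_right power2_norm_eq_inner)
    show "y \<bullet> T y \<le> r * (norm y)\<^sup>2" "T y \<bullet> T (T y) \<le> r * (norm (T y))\<^sup>2"
      by (intro *; simp add: that PT T.zero)+
  qed
  have ker: "y \<in> spec_space r" if y: "P y = 0" for y
  proof -
    have "P ((T ^^ n) y) = 0 \<and> norm ((T ^^ n) y) \<le> r ^ n * norm y" for n
    proof (induction n)
      case (Suc n)
      then have "norm (T ((T ^^ n) y)) \<le> r * (r ^ n * norm y)"
        using False by (intro order_trans[OF Tle] mult_left_mono) auto
      then show ?case using Suc by (simp add: PT T.zero mult_ac)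
    qed (simp add: y)
    then show ?thesis by (simp add: spec_space_def)
  qed
  \<comment> \<open>The range of \<open>N\<close> lies in the kernel of \<open>P\<close>, hence in
    \<open>spec_space r\<close>, so \<open>x\<close> is orthogonal to
    \<open>N (N x)\<close>.\<close>
  have "N x \<bullet> N x = x \<bullet> N (N x)" by (rule selfadjoint_opD(2)[OF N])
  also have "\<dots> = 0" by (intro x ker PN)
  finally have "N x = 0" by simp
  from pos[OF this] show ?thesis by (simp add: B_def inner_diff_right power2_norm_eq_inner)
qed

end

subsection \<open>The resolution of the identity\<close>

text \<open>At the vector \<open>Q x\<close> the form of \<open>Q\<close> already exhausts the
  squared norm and leaves nothing for \<open>P\<close>.\<close>

lemma orth_proj_orthogonal:
  assumes P: "orth_proj P" and Q: "orth_proj Q" and le: "\<And>x. x \<bullet> P x + x \<bullet> Q x \<le> (norm x)\<^sup>2"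
  shows "P (Q x) = 0"
proof -
  have "(norm (P (Q x)))\<^sup>2 \<le> 0"
    using le[of "Q x"] orth_projD(4)[OF Q, of x] orth_projD(5)[OF P, of "Q x"]
    by (simp only: power2_norm_eq_inner)
  then show ?thesis by simp
qed

text \<open>The bound on the quadratic forms makes the projections mutually orthogonal.\<close>

lemma orth_proj_sums:
  fixes P :: "nat \<Rightarrow> 'a::{real_inner,complete_space} \<Rightarrow> 'a"
  assumes P: "\<And>n. orth_proj (P n)" and le: "\<And>n x. (\<Sum>i<n. x \<bullet> P i x) \<le> (norm x)\<^sup>2"
  shows "\<exists>Q. orth_proj Q \<and> (\<forall>x. (\<lambda>n. P n x) sums Q x)"
proof -
  have pos: "0 \<le> x \<bullet> P i x" for x i using orth_projD(5)[OF P, of x i] by simp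
  have orth: "P i (P j x) = 0" if "i \<noteq> j" for i j x
  proof (rule orth_proj_orthogonal[OF P P])
    fix x
    have "x \<bullet> P i x + x \<bullet> P j x = (\<Sum>k\<in>{i, j}. x \<bullet> P k x)" using that by simp
    also have "\<dots> \<le> (\<Sum>k<Suc (max i j). x \<bullet> P k x)" using pos by (intro sum_mono2) auto
    also have "\<dots> \<le> (norm x)\<^sup>2" by (rule le)
    finally show "x \<bullet> P i x + x \<bullet> P j x \<le> (norm x)\<^sup>2" .
  qed
  define S where "S n x = (\<Sum>i<n. P i x)" for n x
  define s where "s n x = (\<Sum>i<n. x \<bullet> P i x)" for n x
  have inner_P: "P i x \<bullet> P j x = (if i = j then x \<bullet> P i x else 0)" for i j x
    using orth[of i j x] orth_projD(3)[OF P, of i x "P j x"] orth_projD(4)[OF P, of i x] by auto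
  \<comment> \<open>Pythagoras: squared distances of partial sums are increments of the monotone
    bounded sequence \<open>s\<close>, which gives convergence.\<close>
  have dist: "(norm (S n x - S m x))\<^sup>2 = s n x - s m x" if "m \<le> n" for m n x
  proof -
    have "S n x - S m x = (\<Sum>i\<in>{m..<n}. P i x)" and s: "s n x - s m x = (\<Sum>i\<in>{m..<n}. x \<bullet> P i x)"
      using that by (simp_all add: S_def s_def sum_diff_nat_ivl lessThan_atLeast0)
    then show ?thesis
      by (simp add: power2_norm_eq_inner inner_sum_left inner_sum_right inner_P if_distrib sum.delta cong: if_cong)
  qed
  have bd: "norm (S n x) \<le> 1 * norm x" for n x
  proof -
    have "(norm (S n x))\<^sup>2 \<le> (norm x)\<^sup>2" using dist[OF le0, of n x] le[of x n] by (simp add: S_def s_def)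
    then show ?thesis using power2_le_imp_le[OF _ norm_ge_zero] by simp
  qed
  have S: "selfadjoint_op (S n)" for n
  proof (induction n)
    case 0
    show ?case by (simp add: S_def selfadjoint_op_def)
  next
    case (Suc n)
    have "S (Suc n) = (\<lambda>x. 1 *\<^sub>R S n x + 1 *\<^sub>R P n x)" by (simp add: S_def fun_eq_iff)
    then show ?case by (simp only: selfadjoint_op_linear_comb[OF Suc orth_projD(1)[OF P]])
  qed
  define Q where "Q x = lim (\<lambda>n. S n x)" for x
  have "convergent (\<lambda>n. S n x)" for x
  proof -
    have inc: "incseq (\<lambda>n. s n x)" using pos by (intro incseq_SucI) (simp add: s_def)
    have "s n x \<le> (norm x)\<^sup>2" for n unfolding s_def by (rule le)
    then obtain L where L: "(\<lambda>n. s n x) \<longlonglongrightarrow> L" "\<And>n. s n x \<le> L"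
      using incseq_convergent[OF inc] by blast
    show ?thesis
    proof (rule convergent_dist_power_le)
      show "(\<lambda>n. L - s n x) \<longlonglongrightarrow> 0" using tendsto_diff[OF tendsto_const L(1), of L] by simp
      show "dist (S m x) (S n x) ^ 2 \<le> L - s m x" if "m \<le> n" for m n
        using dist[OF that, of x] L(2)[of n] by (simp add: dist_norm norm_minus_commute)
    qed
  qed
  then have lim: "(\<lambda>n. S n x) \<longlonglongrightarrow> Q x" for x by (simp only: convergent_LIMSEQ_iff Q_def)
  \<comment> \<open>This yields \<open>S n (Q x) = S n x\<close>, and idempotence of
    \<open>Q\<close> follows in the limit.\<close>
  have "P j (Q x) = P j x" for j x
  proof (rule LIMSEQ_unique)
    show "(\<lambda>n. P j (S n x)) \<longlonglongrightarrow> P j (Q x)"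
      using lim bounded_linear.tendsto[OF orth_projD(2)[OF P]] by blast
    have "P j (S n x) = P j x" if "j < n" for n
    proof -
      have "P j (S n x) = (\<Sum>i<n. P j (P i x))"
        by (simp add: S_def linear_sum[OF bounded_linear.linear[OF orth_projD(2)[OF P]]])
      also have "\<dots> = (\<Sum>i<n. if i = j then P j x else 0)"
        using orth orth_projD(4)[OF P] by (intro sum.cong) auto
      also have "\<dots> = P j x" using that by simp
      finally show ?thesis .
    qed
    then show "(\<lambda>n. P j (S n x)) \<longlonglongrightarrow> P j x"
      by (intro tendsto_eventually) (auto simp: eventually_sequentially intro!: exI[of _ "Suc j"])
  qed
  then have "S n (Q x) = S n x" for n x by (simp add: S_def)
  then have "Q (Q x) = Q x" for x by (simp add: Q_def)
  then have "orth_proj Q" using selfadjoint_op_limit(1)[OF S bd lim] by (intro orth_projI)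
  then show ?thesis using lim by (auto simp: sums_def S_def)
qed

text \<open>Over \<open>n\<close> equal pieces the increments of \<open>m\<close> telescope, so the
  total change of \<open>D\<close> is at most \<open>(b - a) * (m b - m a) / n\<close>. This
  replaces Riemann-Stieltjes sums in \<open>integral_distr_measure\<close>.\<close>

lemma eq_if_variation_le:
  fixes D m :: "real \<Rightarrow> real"
  assumes ab: "a \<le> b"
    and le: "\<And>r s. a \<le> r \<Longrightarrow> r \<le> s \<Longrightarrow> s \<le> b \<Longrightarrow> \<bar>D s - D r\<bar> \<le> (s - r) * (m s - m r)"
  shows "D b = D a"
proof (rule ccontr)
  assume "D b \<noteq> D a"
  then have pos: "\<bar>D b - D a\<bar> > 0" by simp
  have *: "real n * \<bar>D b - D a\<bar> \<le> (b - a) * (m b - m a)" if n: "n > 0" for n :: nat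
  proof -
    define h where "h = (b - a) / real n"
    have h: "h \<ge> 0" and hn: "real n * h = b - a" using ab n by (simp_all add: h_def)
    have "\<bar>D (a + real k * h) - D a\<bar> \<le> h * (m (a + real k * h) - m a)" if "k \<le> n" for k
      using that
    proof (induction k)
      case (Suc k)
      have "a + real (Suc k) * h \<le> b"
        using hn mult_right_mono[OF _ h, of "real (Suc k)" "real n"] Suc.prems by simp
      then have "\<bar>D (a + real (Suc k) * h) - D (a + real k * h)\<bar>
        \<le> (a + real (Suc k) * h - (a + real k * h)) * (m (a + real (Suc k) * h) - m (a + real k * h))"
        using h by (intro le) (auto simp: algebra_simps)
      also have "\<dots> = h * (m (a + real (Suc k) * h) - m (a + real k * h))" by (simp add: algebra_simps)
      finally show ?case using Suc by (simp only: right_diff_distrib) linarith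
    qed simp
    from this[of n] hn have "\<bar>D b - D a\<bar> \<le> h * (m b - m a)" by simp
    then have "real n * \<bar>D b - D a\<bar> \<le> real n * (h * (m b - m a))" by (intro mult_left_mono) auto
    then show ?thesis using hn by (simp add: mult.assoc[symmetric])
  qed
  obtain n where n: "(b - a) * (m b - m a) < real n * \<bar>D b - D a\<bar>"
    using reals_Archimedean3[OF pos] by blast
  have "0 \<le> (b - a) * (m b - m a)" using le[OF order_refl ab order_refl] by linarith
  with n have "n > 0" by (cases n) auto
  from *[OF this] n show False by linarith
qed

section \<open>Spectral projections of half-lines\<close>

context positive_op
begin

definition res :: "real \<Rightarrow> 'a \<Rightarrow> 'a" where
  "res r = (SOME P. orth_proj P \<and> range P = spec_space r \<and> (\<forall>x. \<forall>v\<in>spec_space r. (x - P x) \<bullet> v = 0))"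

lemma res: "orth_proj (res r)" "range (res r) = spec_space r"
  "v \<in> spec_space r \<Longrightarrow> (x - res r x) \<bullet> v = 0"
proof -
  have "orth_proj (res r) \<and> range (res r) = spec_space r \<and>
      (\<forall>x. \<forall>v\<in>spec_space r. (x - res r x) \<bullet> v = 0)"
    unfolding res_def by (rule someI_ex[OF orth_proj_exists[OF subspace_spec_space closed_spec_space]])
  then show "orth_proj (res r)" "range (res r) = spec_space r"
    "v \<in> spec_space r \<Longrightarrow> (x - res r x) \<bullet> v = 0" by blast+
qed

lemma res_in: "res r x \<in> spec_space r"
  using res(2) by blast

lemma res_id: "v \<in> spec_space r \<Longrightarrow> res r v = v"
  using res(2) orth_projD(4)[OF res(1)] by (metis imageE)

lemma res_neg: "r < 0 \<Longrightarrow> res r x = 0"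
  using res_in[of r x] by (simp add: spec_space_neg)

lemma res_ge: "onorm T \<le> r \<Longrightarrow> res r x = x"
  by (intro res_id) (simp add: spec_space_UNIV)

lemma res_orthogonal: "(\<And>v. v \<in> spec_space r \<Longrightarrow> x \<bullet> v = 0) \<Longrightarrow> res r x = 0"
  using orth_projD(5)[OF res(1), of x r] res_in[of r x] by simp

lemma res_diff:
  assumes "r \<le> s"
  shows "res s x - res r x \<in> spec_space s" "v \<in> spec_space r \<Longrightarrow> (res s x - res r x) \<bullet> v = 0"
    "(norm (res s x - res r x))\<^sup>2 = (norm (res s x))\<^sup>2 - (norm (res r x))\<^sup>2"
proof -
  have sub: "spec_space r \<subseteq> spec_space s" using assms by (rule spec_space_mono)
  show "res s x - res r x \<in> spec_space s"
    using sub res_in by (intro subspace_diff subspace_spec_space) auto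
  show orth: "(res s x - res r x) \<bullet> v = 0" if "v \<in> spec_space r" for v
    using res(3)[OF that, of x] res(3)[of v s x] that sub by (auto simp: inner_diff_left)
  show "(norm (res s x - res r x))\<^sup>2 = (norm (res s x))\<^sup>2 - (norm (res r x))\<^sup>2"
    using orth[OF res_in[of r x]]
    by (simp add: power2_norm_eq_inner inner_diff_left inner_diff_right inner_commute)
qed

text \<open>Invariance of \<open>spec_space r\<close> removes the cross terms, so the increment of
  \<open>q\<close> is the form of \<open>T\<close> at \<open>res s x - res r x\<close>. That vector
  lies in \<open>spec_space s\<close> and is orthogonal to \<open>spec_space r\<close>, so both
  spectral bounds apply.\<close>

lemma res_form_diff:
  assumes "r \<le> s"
  defines "q \<equiv> \<lambda>r x. res r x \<bullet> T (res r x)" and "m \<equiv> \<lambda>r x. (norm (res r x))\<^sup>2"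
  shows "r * (m s x - m r x) \<le> q s x - q r x" "q s x - q r x \<le> s * (m s x - m r x)"
proof -
  define d where "d = res s x - res r x"
  have "d \<bullet> T (res r x) = 0"
    unfolding d_def using res_in by (intro res_diff(2)[OF assms(1)] spec_space_invariant)
  moreover have "res r x \<bullet> T d = 0" using calculation sym[of "res r x" d] by (simp add: inner_commute)
  moreover have "res s x = res r x + d" by (simp add: d_def)
  ultimately have q: "q s x - q r x = d \<bullet> T d"
    by (simp add: q_def T.add inner_add_left inner_add_right)
  have m: "m s x - m r x = (norm d)\<^sup>2" unfolding m_def d_def res_diff(3)[OF assms(1)] ..
  show "r * (m s x - m r x) \<le> q s x - q r x"
    unfolding q m d_def by (intro spec_space_lower res_diff(2)[OF assms(1)])
  show "q s x - q r x \<le> s * (m s x - m r x)"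
    unfolding q m d_def by (intro spec_space_upper res_diff(1)[OF assms(1)])
qed

lemma norm_res_mono: "r \<le> s \<Longrightarrow> (norm (res r x))\<^sup>2 \<le> (norm (res s x))\<^sup>2"
  using res_diff(3)[of r s x] zero_le_power2[of "norm (res s x - res r x)"] by linarith

text \<open>As \<open>s\<close> decreases to \<open>r\<close> the projections of \<open>x\<close>
  converge to some \<open>z\<close> lying in every larger spectral subspace, hence in
  \<open>spec_space r\<close>; since \<open>x - z\<close> is orthogonal to that space,
  \<open>z\<close> is \<open>res r x\<close>. Right continuity is what
  \<open>interval_measure\<close> requires.\<close>

lemma norm_res_right_continuous: "continuous (at_right r) (\<lambda>s. (norm (res s x))\<^sup>2)"
  unfolding continuous_within
proof (rule tendsto_at_right_sequentially[of r "r + 1"])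
  fix S :: "nat \<Rightarrow> real"
  assume S: "\<And>n. r < S n" "decseq S" "S \<longlonglongrightarrow> r"
  let ?m = "\<lambda>s. (norm (res s x))\<^sup>2"
  have dec: "decseq (\<lambda>n. ?m (S n))"
    using S(2) unfolding decseq_def by (intro allI impI norm_res_mono) blast
  obtain L where L: "(\<lambda>n. ?m (S n)) \<longlonglongrightarrow> L" "\<And>n. L \<le> ?m (S n)"
    using decseq_convergent[OF dec, of 0] by auto
  have "convergent (\<lambda>n. res (S n) x)"
  proof (rule convergent_dist_power_le)
    show "(\<lambda>n. ?m (S n) - L) \<longlonglongrightarrow> 0" using tendsto_diff[OF L(1) tendsto_const, of L] by simp
    show "dist (res (S m) x) (res (S n) x) ^ 2 \<le> ?m (S m) - L" if "m \<le> n" for m n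
      using res_diff(3)[OF decseqD[OF S(2) that], of x] L(2)[of n] by (simp add: dist_norm)
  qed
  then obtain z where z: "(\<lambda>n. res (S n) x) \<longlonglongrightarrow> z" by (auto simp: convergent_def)
  have "z \<in> spec_space r"
  proof (rule spec_space_right_continuous)
    fix s assume s: "s > r"
    have "\<forall>\<^sub>F n in sequentially. S n < s" using S(3) s by (rule order_tendstoD)
    then have "\<forall>\<^sub>F n in sequentially. res (S n) x \<in> spec_space s"
      by eventually_elim (use res_in spec_space_mono less_imp_le in blast)
    then show "z \<in> spec_space s"
      using Lim_in_closed_set[OF closed_spec_space _ sequentially_bot z] by blast
  qed
  moreover have "(x - z) \<bullet> v = 0" if v: "v \<in> spec_space r" for v
  proof -
    have "(x - res (S n) x) \<bullet> v = 0" for n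
      using v spec_space_mono[OF less_imp_le[OF S(1)]] by (intro res(3)) auto
    moreover have "(\<lambda>n. (x - res (S n) x) \<bullet> v) \<longlonglongrightarrow> (x - z) \<bullet> v" by (intro tendsto_intros z)
    ultimately show ?thesis by (simp add: LIMSEQ_const_iff)
  qed
  ultimately have "z = res r x"
    using res_orthogonal[of r "x - z"] res_id[of z r]
    by (simp add: linear_diff[OF bounded_linear.linear[OF orth_projD(2)[OF res(1)]]])
  then show "(\<lambda>n. ?m (S n)) \<longlonglongrightarrow> ?m r" using tendsto_power[OF tendsto_norm[OF z]] by blast
qed simp

end

subsection \<open>The spectral measure\<close>

lemma set_integrable_id_Ioc:
  fixes M :: "real measure"
  assumes "finite_measure M" "sets M = sets borel"
  shows "set_integrable M {a<..b} (\<lambda>t. t)"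
proof -
  interpret finite_measure M by fact
  have "\<bar>indicator {a<..b} t * t\<bar> \<le> \<bar>a\<bar> + \<bar>b\<bar>" for t :: real
    by (auto simp: indicator_def)
  then show ?thesis
    unfolding set_integrable_def using assms(2)
    by (intro integrable_const_bound[where B = "\<bar>a\<bar> + \<bar>b\<bar>"]) (auto simp: measurable_def)
qed

lemma set_integral_id_Ioc_bounds:
  fixes M :: "real measure"
  assumes M: "finite_measure M" "sets M = sets borel"
  shows "a * measure M {a<..b} \<le> (LINT t:{a<..b}|M. t)" "(LINT t:{a<..b}|M. t) \<le> b * measure M {a<..b}"
proof -
  interpret finite_measure M by fact
  note [simp] = M(2)
  have i: "set_integrable M {a<..b} (\<lambda>t. c)" for c :: real
    unfolding set_integrable_def
  proof (rule integrable_const_bound[where B = "\<bar>c\<bar>"])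
    show "(\<lambda>t. indicat_real {a<..b} t *\<^sub>R c) \<in> borel_measurable M"
      by (intro borel_measurable_scaleR borel_measurable_indicator borel_measurable_const) simp
  qed (auto simp: indicator_def)
  have c: "(LINT t:{a<..b}|M. c) = c * measure M {a<..b}" for c :: real
    by (simp add: set_lebesgue_integral_def)
  show "a * measure M {a<..b} \<le> (LINT t:{a<..b}|M. t)"
    unfolding c[symmetric] by (intro set_integral_mono i set_integrable_id_Ioc M) auto
  show "(LINT t:{a<..b}|M. t) \<le> b * measure M {a<..b}"
    unfolding c[symmetric] by (intro set_integral_mono i set_integrable_id_Ioc M) auto
qed

context positive_op
begin

text \<open>A Stieltjes measure that precedes any projection-valued measure: the projections of
  general Borel sets are recovered from it, and only then is it recognised as
  \<open>spectral_distribution spec_proj x\<close>.\<close>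

definition distr_measure :: "'a \<Rightarrow> real measure" where
  "distr_measure x = interval_measure (\<lambda>r. (norm (res r x))\<^sup>2)"

lemma sets_distr_measure [simp, measurable_cong]: "sets (distr_measure x) = sets borel"
  by (simp add: distr_measure_def)

lemma space_distr_measure [simp]: "space (distr_measure x) = UNIV"
  by (simp add: distr_measure_def)

lemma emeasure_distr_measure_Ioc:
  "a \<le> b \<Longrightarrow> emeasure (distr_measure x) {a<..b} = ennreal ((norm (res b x))\<^sup>2 - (norm (res a x))\<^sup>2)"
  unfolding distr_measure_def
  by (rule emeasure_interval_measure_Ioc[OF _ norm_res_mono norm_res_right_continuous])

lemma emeasure_distr_measure_outside: "emeasure (distr_measure x) (UNIV - {0..onorm T}) = 0"
proof -
  \<comment> \<open>The measure is known on half-open intervals. Those on the left must stop short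
    of 0, since the kernel of \<open>T\<close> can produce an atom there.\<close>
  let ?A = "\<Union>n. {- real n - 1<..- inverse (real (Suc n))}" and ?B = "\<Union>n. {onorm T<..onorm T + real n}"
  have "t \<in> ?A" if t: "t < 0" for t
  proof -
    obtain n where n: "inverse (real (Suc n)) < - t" using reals_Archimedean[of "- t"] t by auto
    obtain k where k: "- t < real k" using reals_Archimedean2 by blast
    have "inverse (real (Suc (max n k))) \<le> inverse (real (Suc n))" "real k \<le> real (max n k)"
      by auto
    then have "t \<in> {- real (max n k) - 1<..- inverse (real (Suc (max n k)))}"
      unfolding greaterThanAtMost_iff using n k by linarith
    then show ?thesis by blast
  qed
  moreover have "t \<in> ?B" if t: "onorm T < t" for t
  proof -
    obtain k where "t - onorm T < real k" using reals_Archimedean2 by blast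
    then show ?thesis using t by (auto intro!: exI[of _ k])
  qed
  ultimately have sub: "UNIV - {0..onorm T} \<subseteq> ?A \<union> ?B"
    by (intro subsetI) (simp only: Diff_iff UNIV_I atLeastAtMost_iff de_Morgan_conj not_le Un_iff simp_thms, blast)
  have "emeasure (distr_measure x) {- real n - 1<..- inverse (real (Suc n))} = 0" for n
  proof -
    have "inverse (real (Suc n)) \<le> 1" "inverse (real (Suc n)) > 0" by (simp_all add: inverse_le_1_iff)
    then show ?thesis by (subst emeasure_distr_measure_Ioc) (auto simp: res_neg)
  qed
  then have "emeasure (distr_measure x) ?A = 0" by (intro emeasure_UN_eq_0) auto
  moreover have "emeasure (distr_measure x) {onorm T<..onorm T + real n} = 0" for n
    by (simp add: emeasure_distr_measure_Ioc res_ge)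
  then have "emeasure (distr_measure x) ?B = 0" by (intro emeasure_UN_eq_0) auto
  ultimately have "emeasure (distr_measure x) (?A \<union> ?B) = 0"
    by (intro emeasure_Un_null_set[THEN trans] null_setsI) auto
  then show ?thesis using emeasure_mono[OF sub, of "distr_measure x"] by simp
qed

lemma AE_distr_measure: "AE t in distr_measure x. t \<in> {0..onorm T}"
  by (rule AE_I[OF _ emeasure_distr_measure_outside]) auto

lemma onorm_nonneg: "0 \<le> onorm T"
  by (rule onorm_pos_le[OF T.bounded_linear_axioms])

lemma emeasure_distr_measure_interval: "emeasure (distr_measure x) {0..onorm T} = ennreal ((norm x)\<^sup>2)"
proof -
  \<comment> \<open>The negative left endpoint turns the closed interval into a half-open one that
    keeps a possible atom at 0.\<close>
  have "emeasure (distr_measure x) {0..onorm T} = emeasure (distr_measure x) {-1<..onorm T}"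
    using AE_distr_measure[of x] by (intro emeasure_eq_AE) (auto elim!: eventually_mono)
  also have "\<dots> = ennreal ((norm x)\<^sup>2)"
    using onorm_nonneg by (simp add: emeasure_distr_measure_Ioc res_neg res_ge)
  finally show ?thesis .
qed

lemma emeasure_distr_measure_UNIV: "emeasure (distr_measure x) UNIV = ennreal ((norm x)\<^sup>2)"
  unfolding emeasure_distr_measure_interval[symmetric]
  using AE_distr_measure[of x] by (intro emeasure_eq_AE) auto

lemma finite_distr_measure: "finite_measure (distr_measure x)"
  by (rule finite_measureI) (simp add: emeasure_distr_measure_UNIV)

lemma measure_distr_measure_UNIV: "measure (distr_measure x) UNIV = (norm x)\<^sup>2"
  by (simp add: measure_def emeasure_distr_measure_UNIV)

text \<open>Over \<open>{r<..s}\<close> the form of \<open>T\<close> and the integral both grow by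
  an amount between \<open>r\<close> and \<open>s\<close> times the mass. Their difference
  \<open>D\<close> is therefore constant by \<open>eq_if_variation_le\<close>, and it vanishes at
  -1.\<close>

lemma integral_distr_measure: "x \<bullet> T x = (LINT t:{0..onorm T}|distr_measure x. t)"
proof -
  let ?M = "distr_measure x" and ?m = "\<lambda>r. (norm (res r x))\<^sup>2"
  define D where "D s = res s x \<bullet> T (res s x) - (LINT t:{-1<..s}|?M. t)" for s
  have "D (onorm T) = D (-1)"
  proof (rule eq_if_variation_le[where D = D and m = ?m])
    show "- 1 \<le> onorm T" using onorm_nonneg by simp
    fix r s :: real assume rs: "-1 \<le> r" "r \<le> s" "s \<le> onorm T"
    have meas: "measure ?M {r<..s} = ?m s - ?m r"
      using rs norm_res_mono[of r s x] by (simp add: measure_def emeasure_distr_measure_Ioc)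
    have "{-1<..s} = {-1<..r} \<union> {r<..s}" using rs by auto
    then have "(LINT t:{-1<..s}|?M. t) = (LINT t:{-1<..r}|?M. t) + (LINT t:{r<..s}|?M. t)"
      by (simp only:) (intro set_integral_Un set_integrable_id_Ioc finite_distr_measure, auto)
    then show "\<bar>D s - D r\<bar> \<le> (s - r) * (?m s - ?m r)"
      using res_form_diff[OF rs(2), of x] set_integral_id_Ioc_bounds[OF finite_distr_measure, of x r s]
      by (simp add: D_def meas left_diff_distrib abs_le_iff)
  qed
  moreover have "(LINT t:{-1<..onorm T}|?M. t) = (LINT t:{0..onorm T}|?M. t)"
    using AE_distr_measure[of x]
    unfolding set_lebesgue_integral_def
    by (intro integral_cong_AE borel_measurable_scaleR borel_measurable_indicator)
      (auto simp: indicator_def elim!: eventually_mono)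
  ultimately show ?thesis
    by (simp add: D_def res_neg res_ge T.zero set_lebesgue_integral_def)
qed

text \<open>The total mass \<open>(norm x)\<^sup>2\<close> provides the bound needed by
  \<open>orth_proj_sums\<close>. The result serves both the disjoint unions of the Dynkin argument
  and the countable additivity of \<open>spec_proj\<close>.\<close>

lemma distr_measure_projection_sums:
  assumes A: "\<And>i. A i \<in> sets borel" "disjoint_family A"
    and P: "\<And>i. orth_proj (P i)" "\<And>i x. x \<bullet> P i x = measure (distr_measure x) (A i)"
  shows "\<exists>Q. orth_proj Q \<and> (\<forall>x. (\<lambda>n. P n x) sums Q x) \<and>
    (\<forall>x. x \<bullet> Q x = measure (distr_measure x) (\<Union>i::nat. A i))"
proof -
  have sums: "(\<lambda>i. measure (distr_measure x) (A i)) sums measure (distr_measure x) (\<Union>i. A i)" for x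
    using A by (intro finite_measure.finite_measure_UNION finite_distr_measure) auto
  have "(\<Sum>i<n. x \<bullet> P i x) \<le> (norm x)\<^sup>2" for n x
  proof -
    have "(\<Sum>i<n. x \<bullet> P i x) \<le> measure (distr_measure x) (\<Union>i. A i)"
      unfolding P(2)
      using sum_le_suminf[OF sums_summable[OF sums[of x]], of "{..<n}"] sums_unique[OF sums[of x]] by simp
    also have "\<dots> \<le> measure (distr_measure x) UNIV"
      using finite_measure.bounded_measure[OF finite_distr_measure[of x]] by simp
    finally show ?thesis by (simp add: measure_distr_measure_UNIV)
  qed
  from orth_proj_sums[OF P(1) this] obtain Q where Q: "orth_proj Q" "\<And>x. (\<lambda>n. P n x) sums Q x" by blast
  have "x \<bullet> Q x = measure (distr_measure x) (\<Union>i. A i)" for x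
  proof (rule sums_unique2)
    show "(\<lambda>i. measure (distr_measure x) (A i)) sums (x \<bullet> Q x)"
      unfolding P(2)[symmetric] by (rule bounded_linear.sums[OF bounded_linear_inner_right Q(2)])
  qed (rule sums)
  with Q show ?thesis by blast
qed

text \<open>Complements and disjoint unions preserve the existence of a projection, whereas
  intersections are not directly accessible. Hence the induction starts from the intersection-stable
  half-open intervals, where differences of \<open>res\<close> serve.\<close>

lemma distr_measure_projection:
  assumes "B \<in> sets borel"
  shows "\<exists>P. orth_proj P \<and> (\<forall>x. x \<bullet> P x = measure (distr_measure x) B)"
proof -
  have int: "Int_stable (range (\<lambda>(a, b). {a<..b::real}))"
    unfolding Int_stable_def by auto
  have B: "B \<in> sigma_sets UNIV (range (\<lambda>(a, b). {a<..b::real}))"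
    using assms by (simp only: borel_sigma_sets_Ioc sets_measure_of_conv) simp
  have borel: "A \<in> sets borel" if "A \<in> sigma_sets UNIV (range (\<lambda>(a, b). {a<..b::real}))" for A
    using that by (simp only: borel_sigma_sets_Ioc sets_measure_of_conv) simp
  note zero = orth_projI[of "\<lambda>x. 0 :: 'a", unfolded selfadjoint_op_def, simplified]
  have closed: "range (\<lambda>(a, b). {a<..b::real}) \<subseteq> Pow UNIV" by simp
  show ?thesis
    using int closed B
  proof (induction rule: sigma_sets_induct_disjoint)
    case (basic A)
    then obtain a b where A: "A = {a<..b}" by auto
    show ?case
    proof (cases "a \<le> b")
      case True
      define P where "P x = 1 *\<^sub>R res b x + (-1) *\<^sub>R res a x" for x
      note lin = bounded_linear.linear[OF orth_projD(2)[OF res(1)]]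
      have "res b (res a x) = res a x" for x
        using res_in spec_space_mono[OF True] by (intro res_id) auto
      moreover have "res a (res b x) = res a x" for x
      proof -
        have "res a (res b x - res a x) = 0" by (intro res_orthogonal res_diff(2)[OF True])
        then show ?thesis using res_id[OF res_in, of a] by (simp add: linear_diff[OF lin])
      qed
      ultimately have "P (P x) = P x" for x
        using res_id[OF res_in] by (simp add: P_def linear_diff[OF lin])
      moreover have "selfadjoint_op P"
        unfolding P_def by (intro selfadjoint_op_linear_comb orth_projD(1)[OF res(1)])
      ultimately have "orth_proj P" by (intro orth_projI)
      moreover have "x \<bullet> P x = measure (distr_measure x) A" for x
        using True norm_res_mono[OF True, of x]
        by (simp add: P_def A inner_diff_right orth_projD(5)[OF res(1)] measure_def emeasure_distr_measure_Ioc)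
      ultimately show ?thesis by blast
    qed (use zero A in \<open>auto intro!: exI[of _ "\<lambda>x. 0"]\<close>)
  next
    case empty
    show ?case using zero by (auto intro!: exI[of _ "\<lambda>x. 0"])
  next
    case (compl A)
    then obtain P where P: "orth_proj P" "\<And>x. x \<bullet> P x = measure (distr_measure x) A" by blast
    define Q where "Q x = 1 *\<^sub>R x + (-1) *\<^sub>R P x" for x
    have "selfadjoint_op Q"
      unfolding Q_def by (intro selfadjoint_op_linear_comb selfadjoint_op_id orth_projD(1)[OF P(1)])
    moreover have "Q (Q x) = Q x" for x
      by (simp add: Q_def linear_diff[OF bounded_linear.linear[OF orth_projD(2)[OF P(1)]]] orth_projD(4)[OF P(1)])
    ultimately have "orth_proj Q" by (rule orth_projI)
    moreover have "x \<bullet> Q x = measure (distr_measure x) (UNIV - A)" for x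
      using finite_measure.finite_measure_compl[OF finite_distr_measure[of x], of A] borel[OF compl(1)]
      by (simp add: Q_def inner_diff_right P(2) measure_distr_measure_UNIV power2_norm_eq_inner)
    ultimately show ?case by blast
  next
    case (union A)
    then obtain P where P: "\<And>i. orth_proj (P i)" "\<And>i x. x \<bullet> P i x = measure (distr_measure x) (A i)"
      by metis
    have "A i \<in> sets borel" for i using union(2) borel by auto
    from distr_measure_projection_sums[OF this union(1) P] show ?case by blast
  qed
qed

definition spec_proj :: "real set \<Rightarrow> 'a \<Rightarrow> 'a" where
  "spec_proj B = (SOME P. orth_proj P \<and> (\<forall>x. x \<bullet> P x = measure (distr_measure x) B))"

lemma spec_proj:
  assumes "B \<in> sets borel"
  shows "orth_proj (spec_proj B)" "x \<bullet> spec_proj B x = measure (distr_measure x) B"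
proof -
  have "orth_proj (spec_proj B) \<and> (\<forall>x. x \<bullet> spec_proj B x = measure (distr_measure x) B)"
    unfolding spec_proj_def by (rule someI_ex[OF distr_measure_projection[OF assms]])
  then show "orth_proj (spec_proj B)" "x \<bullet> spec_proj B x = measure (distr_measure x) B" by blast+
qed

lemma orth_proj_id: "orth_proj id"
  by (intro orth_projI) (simp_all add: id_def selfadjoint_op_id)

lemma projection_valued_measure_spec_proj: "projection_valued_measure spec_proj"
  unfolding projection_valued_measure_def
proof (intro conjI ballI allI impI)
  show "selfadjoint_op (spec_proj B)" "spec_proj B \<circ> spec_proj B = spec_proj B" if "B \<in> sets borel" for B
    using spec_proj(1)[OF that] by (auto simp: orth_proj_def)
  show "spec_proj UNIV = id"
    by (rule orth_proj_eqI[OF spec_proj(1) orth_proj_id])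
      (simp_all add: spec_proj(2) measure_distr_measure_UNIV power2_norm_eq_inner)
  fix B :: "nat \<Rightarrow> real set" and x
  assume B: "range B \<subseteq> sets borel" "disjoint_family B"
  then have Bi: "B i \<in> sets borel" and Bu: "(\<Union>i. B i) \<in> sets borel" for i by auto
  from distr_measure_projection_sums[OF Bi B(2) spec_proj(1)[OF Bi] spec_proj(2)[OF Bi]]
  obtain Q where Q: "orth_proj Q" "\<And>x. (\<lambda>n. spec_proj (B n) x) sums Q x"
    "\<And>x. x \<bullet> Q x = measure (distr_measure x) (\<Union>i. B i)" by blast
  have "x \<bullet> Q x = x \<bullet> spec_proj (\<Union>i. B i) x" for x
    unfolding Q(3) spec_proj(2)[OF Bu] ..
  from orth_proj_eqI[OF Q(1) spec_proj(1)[OF Bu] this] Q(2)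
  show "(\<lambda>n. spec_proj (B n) x) sums spec_proj (\<Union>i. B i) x" by simp
qed

lemma spectral_distribution_spec_proj: "spectral_distribution spec_proj x = distr_measure x"
proof -
  interpret finite_measure "distr_measure x" by (rule finite_distr_measure)
  have "spectral_distribution spec_proj x = measure_of UNIV (sets borel) (emeasure (distr_measure x))"
    unfolding spectral_distribution_def
    by (rule measure_of_eq) (auto simp: spec_proj(2) emeasure_eq_measure sets.sigma_sets_eq[of borel, simplified])
  also have "\<dots> = distr_measure x" using measure_of_of_measure[of "distr_measure x"] by simp
  finally show ?thesis .
qed

lemma is_spectral_measure_spec_proj: "is_spectral_measure {0..onorm T} T spec_proj"
  unfolding is_spectral_measure_def spectral_distribution_spec_proj
proof (intro conjI allI)
  show "spec_proj {0..onorm T} = id"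
    by (rule orth_proj_eqI[OF spec_proj(1) orth_proj_id])
      (simp_all add: spec_proj(2) measure_def emeasure_distr_measure_interval power2_norm_eq_inner)
qed (intro projection_valued_measure_spec_proj integral_distr_measure)+

end

subsection \<open>Functional calculus of a projection-valued measure\<close>

text \<open>The bound is global on the line; functions given on the spectral interval are first cut
  off by \<open>on_spec\<close>.\<close>

definition bdd_borel :: "(real \<Rightarrow> real) \<Rightarrow> bool" where
  "bdd_borel f \<longleftrightarrow> f \<in> borel_measurable borel \<and> (\<exists>M. \<forall>t. \<bar>f t\<bar> \<le> M)"

lemma bdd_borelE:
  assumes "bdd_borel f"
  obtains M where "f \<in> borel_measurable borel" "M > 0" "\<And>t. \<bar>f t\<bar> \<le> M"
proof -
  obtain M where M: "f \<in> borel_measurable borel" "\<And>t. \<bar>f t\<bar> \<le> M"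
    using assms by (auto simp: bdd_borel_def)
  have "\<bar>f t\<bar> \<le> \<bar>M\<bar> + 1" for t using M(2)[of t] by linarith
  with M(1) show ?thesis by (intro that[of "\<bar>M\<bar> + 1"]) auto
qed

lemma bdd_borelI: "f \<in> borel_measurable borel \<Longrightarrow> (\<And>t. \<bar>f t\<bar> \<le> M) \<Longrightarrow> bdd_borel f"
  by (auto simp: bdd_borel_def)

lemma bdd_borel_indicator: "B \<in> sets borel \<Longrightarrow> bdd_borel (indicator B)"
  by (rule bdd_borelI[where M = 1]) (auto simp: indicator_def intro!: borel_measurable_indicator)

lemma bdd_borel_linear_comb:
  assumes "bdd_borel f" "bdd_borel h"
  shows "bdd_borel (\<lambda>t. a * f t + b * h t)"
proof -
  from assms obtain M N where M: "f \<in> borel_measurable borel" "\<And>t. \<bar>f t\<bar> \<le> M"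
    and N: "h \<in> borel_measurable borel" "\<And>t. \<bar>h t\<bar> \<le> N" by (auto elim!: bdd_borelE)
  have "\<bar>a * f t + b * h t\<bar> \<le> \<bar>a\<bar> * M + \<bar>b\<bar> * N" for t
    using abs_triangle_ineq[of "a * f t" "b * h t"] mult_left_mono[OF M(2)[of t], of "\<bar>a\<bar>"]
      mult_left_mono[OF N(2)[of t], of "\<bar>b\<bar>"] by (simp add: abs_mult)
  then show ?thesis using M N by (intro bdd_borelI) auto
qed

lemma bdd_borel_mult:
  assumes "bdd_borel f" "bdd_borel h"
  shows "bdd_borel (\<lambda>t. f t * h t)"
proof -
  from assms obtain M N where M: "f \<in> borel_measurable borel" "M > 0" "\<And>t. \<bar>f t\<bar> \<le> M"
    and N: "h \<in> borel_measurable borel" "\<And>t. \<bar>h t\<bar> \<le> N" by (auto elim!: bdd_borelE)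
  have "\<bar>f t * h t\<bar> \<le> M * N" for t
    unfolding abs_mult using M(2,3) N(2) by (intro mult_mono) auto
  then show ?thesis using M N by (intro bdd_borelI) auto
qed

text \<open>A bounded Borel function is the uniform limit of the step functions \<open>\<lfloor>n f\<rfloor> / n\<close>.\<close>

lemma bdd_borel_induct [consumes 1, case_names indicator linear limit]:
  assumes f: "bdd_borel f"
    and ind: "\<And>B. B \<in> sets borel \<Longrightarrow> P (indicator B)"
    and lin: "\<And>a b f h. bdd_borel f \<Longrightarrow> bdd_borel h \<Longrightarrow> P f \<Longrightarrow> P h \<Longrightarrow> P (\<lambda>t. a * f t + b * h t)"
    and lim: "\<And>u f. (\<And>n. bdd_borel (u n)) \<Longrightarrow> (\<And>n. P (u n)) \<Longrightarrow> bdd_borel f \<Longrightarrow>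
      (\<And>n t. \<bar>u n t - f t\<bar> \<le> inverse (real (Suc n))) \<Longrightarrow> P f"
  shows "P f"
proof -
  from f obtain M where M: "f \<in> borel_measurable borel" "\<And>t. \<bar>f t\<bar> \<le> M" by (auto elim!: bdd_borelE)
  note [measurable] = M(1)
  define u where "u n t = inverse (real (Suc n)) * of_int \<lfloor>real (Suc n) * f t\<rfloor>" for n t
  have P_sum: "bdd_borel (\<lambda>t. \<Sum>k\<in>K. c k * indicator (B k) t) \<and> P (\<lambda>t. \<Sum>k\<in>K. c k * indicator (B k) t)"
    if "finite K" "\<And>k. B k \<in> sets borel" for K :: "int set" and c B
    using that(1)
  proof (induction K)
    case empty
    \<comment> \<open>The zero function is obtained as a trivial linear combination, since the
      induction has no case of its own for it.\<close>
    have "bdd_borel (\<lambda>t. 0 * indicator {} t + 0 * indicator {} t)" "P (\<lambda>t. 0 * indicator {} t + 0 * indicator {} t)"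
      by (intro lin bdd_borel_linear_comb bdd_borel_indicator ind; simp)+
    then show ?case by simp
  next
    case (insert k K)
    let ?h = "\<lambda>t. \<Sum>k\<in>K. c k * indicator (B k) t"
    have "P (\<lambda>t. c k * indicator (B k) t + 1 * ?h t)"
      "bdd_borel (\<lambda>t. c k * indicator (B k) t + 1 * ?h t)"
      using insert.IH that(2)
      by (intro lin bdd_borel_linear_comb bdd_borel_indicator ind; blast)+
    then show ?case using insert.hyps by (simp only: sum.insert mult_1 simp_thms)
  qed
  have u: "bdd_borel (u n) \<and> P (u n)" for n
  proof -
    \<comment> \<open>Boundedness of \<open>f\<close> confines the floor to finitely many integers,
      so \<open>u n\<close> is a finite step function.\<close>
    define K where "K = {\<lfloor>- (real (Suc n) * M)\<rfloor>..\<lfloor>real (Suc n) * M\<rfloor>}"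
    define B where "B k = {t. \<lfloor>real (Suc n) * f t\<rfloor> = k}" for k :: int
    have "u n = (\<lambda>t. \<Sum>k\<in>K. (inverse (real (Suc n)) * of_int k) * indicator (B k) t)"
    proof
      fix t
      have "- M \<le> f t" "f t \<le> M" using M(2)[of t] by auto
      then have "real (Suc n) * f t \<le> real (Suc n) * M" "real (Suc n) * (- M) \<le> real (Suc n) * f t"
        by (intro mult_left_mono; simp)+
      then have K: "\<lfloor>real (Suc n) * f t\<rfloor> \<in> K" unfolding K_def by (auto intro!: floor_mono)
      have "(\<Sum>k\<in>K. (inverse (real (Suc n)) * of_int k) * indicator (B k) t)
        = (\<Sum>k\<in>K. if k = \<lfloor>real (Suc n) * f t\<rfloor> then inverse (real (Suc n)) * of_int k else 0)"
        by (intro sum.cong) (auto simp: B_def indicator_def)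
      also have "\<dots> = u n t" using K by (simp add: K_def u_def)
      finally show "u n t = (\<Sum>k\<in>K. (inverse (real (Suc n)) * of_int k) * indicator (B k) t)" ..
    qed
    moreover have "B k \<in> sets borel" for k unfolding B_def by measurable
    ultimately show ?thesis using P_sum[of K B] by (simp add: K_def)
  qed
  have "\<bar>u n t - f t\<bar> \<le> inverse (real (Suc n))" for n t
  proof -
    have "f t = inverse (real (Suc n)) * (real (Suc n) * f t)" by simp
    then have "u n t - f t = inverse (real (Suc n)) * (of_int \<lfloor>real (Suc n) * f t\<rfloor> - real (Suc n) * f t)"
      by (simp only: u_def right_diff_distrib)
    moreover have "\<bar>of_int \<lfloor>real (Suc n) * f t\<rfloor> - real (Suc n) * f t\<bar> \<le> 1" by linarith
    ultimately show ?thesis by (simp add: abs_mult mult_left_le del: of_nat_Suc)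
  qed
  then show ?thesis by (rule lim[OF conjunct1[OF u] conjunct2[OF u] f])
qed

text \<open>An arbitrary projection-valued measure instead of \<open>spec_proj\<close>:
  \<open>spectral_measure\<close> picks an unspecified one, so only the defining properties may be
  used.\<close>

locale spectral_family =
  fixes E :: "real set \<Rightarrow> 'a::{real_inner,complete_space} \<Rightarrow> 'a"
  assumes pvm: "projection_valued_measure E"
begin

lemma orth_proj_E: "B \<in> sets borel \<Longrightarrow> orth_proj (E B)"
  using pvm by (simp add: projection_valued_measure_def orth_proj_def)

lemma E_sums: "range B \<subseteq> sets borel \<Longrightarrow> disjoint_family B \<Longrightarrow> (\<lambda>n. E (B n) x) sums E (\<Union>n. B n) x"
  for B :: "nat \<Rightarrow> real set"
  using pvm by (simp add: projection_valued_measure_def)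

lemma E_UNIV: "E UNIV x = x"
  using pvm by (simp add: projection_valued_measure_def)

lemma E_empty: "E {} x = 0"
proof -
  have "(\<lambda>n::nat. E {} x) sums E {} x"
    using E_sums[of "\<lambda>_. {}" x] by (simp add: disjoint_family_on_def)
  then have "(\<lambda>n::nat. E {} x) \<longlonglongrightarrow> 0" by (intro summable_LIMSEQ_zero sums_summable)
  then show ?thesis by (simp add: LIMSEQ_const_iff)
qed

abbreviation "\<nu> \<equiv> spectral_distribution E"

lemma sets_\<nu> [simp, measurable_cong]: "sets (\<nu> x) = sets borel"
  by (simp add: spectral_distribution_def sets.sigma_sets_eq[of borel, simplified])

lemma space_\<nu> [simp]: "space (\<nu> x) = UNIV"
  by (simp add: spectral_distribution_def)

lemma emeasure_\<nu>:
  assumes B: "B \<in> sets borel"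
  shows "emeasure (\<nu> x) B = ennreal (x \<bullet> E B x)"
proof (rule emeasure_measure_of[OF spectral_distribution_def])
  show "countably_additive (sets (\<nu> x)) (\<lambda>B. ennreal (x \<bullet> E B x))"
    unfolding countably_additive_def
  proof (intro allI impI)
    fix B :: "nat \<Rightarrow> real set"
    assume B: "range B \<subseteq> sets (\<nu> x)" "disjoint_family B" "(\<Union>i. B i) \<in> sets (\<nu> x)"
    then have Bi: "B i \<in> sets borel" for i by auto
    have "(\<lambda>i. x \<bullet> E (B i) x) sums (x \<bullet> E (\<Union>i. B i) x)"
      using B by (intro bounded_linear.sums[OF bounded_linear_inner_right] E_sums) auto
    then show "(\<Sum>i. ennreal (x \<bullet> E (B i) x)) = ennreal (x \<bullet> E (\<Union>i. B i) x)"
      by (intro suminf_ennreal_eq) (simp_all add: orth_projD(5)[OF orth_proj_E[OF Bi]])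
  qed
qed (use B in \<open>auto simp: positive_def E_empty\<close>)

lemma finite_measure_\<nu>: "finite_measure (\<nu> x)"
  by (rule finite_measureI) (simp add: emeasure_\<nu>)

lemma measure_\<nu>: "B \<in> sets borel \<Longrightarrow> measure (\<nu> x) B = x \<bullet> E B x"
  by (simp add: measure_def emeasure_\<nu> orth_projD(5)[OF orth_proj_E])

lemma measure_\<nu>_UNIV: "measure (\<nu> x) UNIV = (norm x)\<^sup>2"
  by (simp add: measure_\<nu> E_UNIV power2_norm_eq_inner)

lemma E_Un:
  assumes "B \<in> sets borel" "C \<in> sets borel" "B \<inter> C = {}"
  shows "E (B \<union> C) x = E B x + E C x"
proof -
  have "E (B \<union> C) = (\<lambda>x. 1 *\<^sub>R E B x + 1 *\<^sub>R E C x)"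
  proof (rule selfadjoint_op_eqI)
    show "x \<bullet> E (B \<union> C) x = x \<bullet> (1 *\<^sub>R E B x + 1 *\<^sub>R E C x)" for x
      using finite_measure.finite_measure_Union[OF finite_measure_\<nu>, of B x C] assms
      by (simp add: measure_\<nu> inner_add_right)
  qed (intro selfadjoint_op_linear_comb orth_projD(1) orth_proj_E assms sets.Un)+
  then show ?thesis by simp
qed

lemma E_disjoint:
  assumes "B \<in> sets borel" "C \<in> sets borel" "B \<inter> C = {}"
  shows "E B (E C x) = 0"
proof (rule orth_proj_orthogonal[OF orth_proj_E orth_proj_E])
  show "x \<bullet> E B x + x \<bullet> E C x \<le> (norm x)\<^sup>2" for x
    using finite_measure.bounded_measure[OF finite_measure_\<nu>[of x], of "B \<union> C"] assms
    by (simp add: measure_\<nu> E_Un measure_\<nu>_UNIV E_UNIV inner_add_right power2_norm_eq_inner)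
qed (use assms in auto)

text \<open>Multiplicativity is derived from additivity: both sets are split along their
  intersection, and projections of disjoint sets annihilate each other because their masses add up
  to at most the squared norm.\<close>

lemma E_Int:
  assumes B: "B \<in> sets borel" and C: "C \<in> sets borel"
  shows "E B (E C x) = E (B \<inter> C) x"
proof -
  have BC: "B \<inter> C \<in> sets borel" "B - C \<in> sets borel" "C - B \<in> sets borel" using B C by auto
  have "E B y = E (B \<inter> C) y + E (B - C) y" for y
  proof -
    have "(B \<inter> C) \<inter> (B - C) = {}" "(B \<inter> C) \<union> (B - C) = B" by auto
    with E_Un[OF BC(1,2), of y] show ?thesis by simp
  qed
  moreover have "E C y = E (B \<inter> C) y + E (C - B) y" for y
  proof -
    have "(B \<inter> C) \<inter> (C - B) = {}" "(B \<inter> C) \<union> (C - B) = C" by auto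
    with E_Un[OF BC(1,3), of y] show ?thesis by simp
  qed
  moreover have "E (B - C) (E C x) = 0" "E (B \<inter> C) (E (C - B) x) = 0"
    by (intro E_disjoint BC C; auto)+
  ultimately show ?thesis
    using orth_projD(4)[OF orth_proj_E[OF BC(1)], of x]
      linear_add[OF bounded_linear.linear[OF orth_projD(2)[OF orth_proj_E[OF BC(1)]]]] by simp
qed

definition represents :: "(real \<Rightarrow> real) \<Rightarrow> ('a \<Rightarrow> 'a) \<Rightarrow> bool" where
  "represents f F \<longleftrightarrow> selfadjoint_op F \<and> (\<forall>x. x \<bullet> F x = (LINT t|\<nu> x. f t))"

lemma integrable_bdd_borel: "bdd_borel f \<Longrightarrow> integrable (\<nu> x) f"
  by (elim bdd_borelE, rule finite_measure.integrable_const_bound[OF finite_measure_\<nu>]) auto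

lemma abs_integral_\<nu>_le:
  assumes f: "bdd_borel f" and c: "\<And>t. \<bar>f t\<bar> \<le> c"
  shows "\<bar>LINT t|\<nu> x. f t\<bar> \<le> c * (norm x)\<^sup>2"
proof -
  interpret finite_measure "\<nu> x" by (rule finite_measure_\<nu>)
  have "\<bar>LINT t|\<nu> x. f t\<bar> \<le> (LINT t|\<nu> x. \<bar>f t\<bar>)" by (rule integral_abs_bound)
  also have "\<dots> \<le> (LINT t|\<nu> x. c)"
    using c by (intro integral_mono integrable_abs integrable_bdd_borel f integrable_const)
  finally show ?thesis by (simp add: measure_\<nu>_UNIV mult.commute)
qed

lemma represents_unique: "represents f F \<Longrightarrow> represents f G \<Longrightarrow> F = G"
  unfolding represents_def by (intro selfadjoint_op_eqI) auto

lemma represents_indicator: "B \<in> sets borel \<Longrightarrow> represents (indicator B) (E B)"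
  by (simp add: represents_def orth_projD(1)[OF orth_proj_E] measure_\<nu>)

lemma represents_linear_comb:
  assumes "represents f F" "represents h H" "bdd_borel f" "bdd_borel h"
  shows "represents (\<lambda>t. a * f t + b * h t) (\<lambda>x. a *\<^sub>R F x + b *\<^sub>R H x)"
  using assms by (simp add: represents_def selfadjoint_op_linear_comb inner_add_right integrable_bdd_borel)

lemma represents_norm_le:
  assumes "represents f F" "bdd_borel f" "\<And>t. \<bar>f t\<bar> \<le> c"
  shows "norm (F x) \<le> c * norm x"
  using assms by (intro selfadjoint_op_norm_le) (auto simp: represents_def intro!: abs_integral_\<nu>_le)

lemma represents_diff_norm_le:
  assumes "represents f F" "bdd_borel f" "represents h H" "bdd_borel h" "\<And>t. \<bar>f t - h t\<bar> \<le> c"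
  shows "norm (F x - H x) \<le> c * norm x"
  using represents_norm_le[OF represents_linear_comb[OF assms(1,3,2,4), of 1 "- 1"]
      bdd_borel_linear_comb[OF assms(2,4)], of c x] assms(5) by simp

text \<open>Uniform closeness of the functions bounds the operator differences, so the operators are
  Cauchy. The factor \<open>c\<close> leaves room for \<open>represents_mult_exists\<close>, where
  multiplication by \<open>f\<close> enlarges the error.\<close>

lemma represents_limit:
  assumes u: "\<And>n. bdd_borel (u n)" and U: "\<And>n. represents (u n) (U n)" and f: "bdd_borel f"
    and close: "\<And>n t. \<bar>u n t - f t\<bar> \<le> c * inverse (real (Suc n))"
  shows "\<exists>F. represents f F \<and> (\<forall>x. (\<lambda>n. U n x) \<longlonglongrightarrow> F x)"
proof -
  have c: "0 \<le> c" using close[of 0 0] by simp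
  have e: "c * inverse (real (Suc n)) \<le> c * inverse (real (Suc m))" if "m \<le> n" for m n
    using that c by (intro mult_left_mono) auto
  define F where "F x = lim (\<lambda>n. U n x)" for x
  have "convergent (\<lambda>n. U n x)" for x
  proof (rule convergent_dist_power_le[where k = 1])
    show "(\<lambda>n. 2 * (c * inverse (real (Suc n))) * norm x) \<longlonglongrightarrow> 0"
      by (intro tendsto_mult_left_zero tendsto_mult_right_zero LIMSEQ_inverse_real_of_nat)
    show "dist (U m x) (U n x) ^ 1 \<le> 2 * (c * inverse (real (Suc m))) * norm x" if mn: "m \<le> n" for m n
    proof -
      have "\<bar>u m t - u n t\<bar> \<le> 2 * (c * inverse (real (Suc m)))" for t
        using close[of m t] close[of n t] e[OF mn] by linarith
      from represents_diff_norm_le[OF U u U u this] show ?thesis by (simp add: dist_norm)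
    qed
  qed
  then have lim: "(\<lambda>n. U n x) \<longlonglongrightarrow> F x" for x by (simp only: convergent_LIMSEQ_iff F_def)
  from f obtain M where M: "\<And>t. \<bar>f t\<bar> \<le> M" by (auto elim!: bdd_borelE)
  have "\<bar>u n t\<bar> \<le> M + c" for n t
    using close[of n t] e[of 0 n] M[of t] by simp
  then have bd: "norm (U n x) \<le> (M + c) * norm x" for n x
    by (intro represents_norm_le[OF U u])
  have sa: "selfadjoint_op (U n)" for n using U by (simp add: represents_def)
  have "x \<bullet> F x = (LINT t|\<nu> x. f t)" for x
  proof (rule LIMSEQ_unique)
    show "(\<lambda>n. x \<bullet> U n x) \<longlonglongrightarrow> x \<bullet> F x" by (intro tendsto_intros lim)
    have b: "norm (x \<bullet> U n x - (LINT t|\<nu> x. f t)) \<le> c * inverse (real (Suc n)) * (norm x)\<^sup>2" for n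
    proof -
      have "x \<bullet> U n x - (LINT t|\<nu> x. f t) = (LINT t|\<nu> x. 1 * u n t + (- 1) * f t)"
        using U[of n] by (simp add: represents_def integrable_bdd_borel[OF u] integrable_bdd_borel[OF f])
      then show ?thesis
        using abs_integral_\<nu>_le[OF bdd_borel_linear_comb[OF u f], of 1 n "- 1" "c * inverse (real (Suc n))" x]
          close[of n] by simp
    qed
    have z: "(\<lambda>n. c * inverse (real (Suc n)) * (norm x)\<^sup>2) \<longlonglongrightarrow> 0"
      using tendsto_mult_left_zero[OF tendsto_mult_right_zero[OF LIMSEQ_inverse_real_of_nat]] .
    have "(\<lambda>n. x \<bullet> U n x - (LINT t|\<nu> x. f t)) \<longlonglongrightarrow> 0"
      by (rule Lim_null_comparison[OF always_eventually[OF allI[OF b]] z])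
    then show "(\<lambda>n. x \<bullet> U n x) \<longlonglongrightarrow> (LINT t|\<nu> x. f t)" by (simp add: LIM_zero_iff)
  qed
  then have "represents f F" using selfadjoint_op_limit(1)[OF sa bd lim] by (simp add: represents_def)
  with lim show ?thesis by blast
qed

text \<open>First round of multiplicativity: \<open>f\<close> varies while the other factor is an
  indicator, starting from \<open>E_Int\<close>. Self-adjointness of the product is carried along
  inside \<open>represents\<close>, so no separate commutation argument arises.\<close>

lemma represents_mult_indicator:
  assumes "bdd_borel f"
  shows "\<exists>F. represents f F \<and> (\<forall>C\<in>sets borel. represents (\<lambda>t. f t * indicator C t) (\<lambda>x. F (E C x)))"
  using assms
proof (induction rule: bdd_borel_induct)
  case (indicator B)
  have "represents (\<lambda>t. indicator B t * indicator C t) (\<lambda>x. E B (E C x))" if "C \<in> sets borel" for C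
    using represents_indicator[of "B \<inter> C"] that indicator by (simp add: E_Int indicator_inter_arith[abs_def])
  then show ?case using represents_indicator[OF indicator] by blast
next
  case (linear a b f h)
  then obtain F H where FH: "represents f F" "represents h H"
    "\<And>C. C \<in> sets borel \<Longrightarrow> represents (\<lambda>t. f t * indicator C t) (\<lambda>x. F (E C x))"
    "\<And>C. C \<in> sets borel \<Longrightarrow> represents (\<lambda>t. h t * indicator C t) (\<lambda>x. H (E C x))" by blast
  have "represents (\<lambda>t. (a * f t + b * h t) * indicator C t) (\<lambda>x. a *\<^sub>R F (E C x) + b *\<^sub>R H (E C x))"
    if C: "C \<in> sets borel" for C
    using represents_linear_comb[OF FH(3)[OF C] FH(4)[OF C], of a b] linear.hyps(1,2) bdd_borel_indicator[OF C]
    by (simp add: bdd_borel_mult algebra_simps)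
  then show ?case using represents_linear_comb[OF FH(1,2) linear.hyps(1,2)] by blast
next
  case (limit u f)
  then obtain U where U: "\<And>n. represents (u n) (U n)"
    "\<And>n C. C \<in> sets borel \<Longrightarrow> represents (\<lambda>t. u n t * indicator C t) (\<lambda>x. U n (E C x))" by metis
  have "\<bar>u n t - f t\<bar> \<le> 1 * inverse (real (Suc n))" for n t
    using limit.hyps(3)[of n t] by simp
  from represents_limit[OF limit.hyps(1) U(1) limit.hyps(2) this]
  obtain F where F: "represents f F" "\<And>x. (\<lambda>n. U n x) \<longlonglongrightarrow> F x" by blast
  have "represents (\<lambda>t. f t * indicator C t) (\<lambda>x. F (E C x))" if C: "C \<in> sets borel" for C
  proof -
    have "\<bar>u n t * indicator C t - f t * indicator C t\<bar> \<le> 1 * inverse (real (Suc n))" for n t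
      using limit.hyps(3)[of n t] by (simp add: indicator_def)
    from represents_limit[OF bdd_borel_mult[OF limit.hyps(1) bdd_borel_indicator[OF C]] U(2)[OF C]
        bdd_borel_mult[OF limit.hyps(2) bdd_borel_indicator[OF C]] this]
    obtain G where G: "represents (\<lambda>t. f t * indicator C t) G" "\<And>x. (\<lambda>n. U n (E C x)) \<longlonglongrightarrow> G x" by blast
    have "G = (\<lambda>x. F (E C x))" using LIMSEQ_unique[OF G(2) F(2)] by blast
    with G(1) show ?thesis by simp
  qed
  with F(1) show ?case by blast
qed

text \<open>Second round: \<open>f\<close> and \<open>F\<close> stay fixed while \<open>h\<close> is
  built up from indicators; continuity of \<open>F\<close> handles the limit. The existential form
  suits the induction, and uniqueness removes it in \<open>represents_mult\<close>.\<close>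

lemma represents_mult_exists:
  assumes f: "bdd_borel f" and F: "represents f F" and h: "bdd_borel h"
  shows "\<exists>H. represents h H \<and> represents (\<lambda>t. f t * h t) (\<lambda>x. F (H x))"
  using h
proof (induction rule: bdd_borel_induct)
  case (indicator C)
  obtain F' where "represents f F'" "\<forall>C\<in>sets borel. represents (\<lambda>t. f t * indicator C t) (\<lambda>x. F' (E C x))"
    using represents_mult_indicator[OF f] by blast
  then show ?case using represents_unique[OF F] represents_indicator indicator by blast
next
  case (linear a b h k)
  then obtain H K where HK: "represents h H" "represents k K"
    "represents (\<lambda>t. f t * h t) (\<lambda>x. F (H x))" "represents (\<lambda>t. f t * k t) (\<lambda>x. F (K x))" by blast
  interpret F: bounded_linear F using F by (simp add: represents_def selfadjoint_op_def)
  have "represents (\<lambda>t. f t * (a * h t + b * k t)) (\<lambda>x. F (a *\<^sub>R H x + b *\<^sub>R K x))"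
    using represents_linear_comb[OF HK(3,4), of a b] linear.hyps(1,2) f
    by (simp add: bdd_borel_mult F.add F.scaleR algebra_simps)
  then show ?case using represents_linear_comb[OF HK(1,2) linear.hyps(1,2)] by blast
next
  case (limit u h)
  then obtain U where U: "\<And>n. represents (u n) (U n)"
    "\<And>n. represents (\<lambda>t. f t * u n t) (\<lambda>x. F (U n x))" by metis
  have "\<bar>u n t - h t\<bar> \<le> 1 * inverse (real (Suc n))" for n t
    using limit.hyps(3)[of n t] by simp
  from represents_limit[OF limit.hyps(1) U(1) limit.hyps(2) this]
  obtain H where H: "represents h H" "\<And>x. (\<lambda>n. U n x) \<longlonglongrightarrow> H x" by blast
  from f obtain M where M: "M > 0" "\<And>t. \<bar>f t\<bar> \<le> M" by (auto elim!: bdd_borelE)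
  have "\<bar>f t * u n t - f t * h t\<bar> \<le> M * inverse (real (Suc n))" for n t
    using mult_mono[OF M(2)[of t] limit.hyps(3)[of n t]] M(1) by (simp add: abs_mult flip: right_diff_distrib)
  from represents_limit[OF bdd_borel_mult[OF f limit.hyps(1)] U(2) bdd_borel_mult[OF f limit.hyps(2)] this]
  obtain G where G: "represents (\<lambda>t. f t * h t) G" "\<And>x. (\<lambda>n. F (U n x)) \<longlonglongrightarrow> G x" by blast
  have "bounded_linear F" using F unfolding represents_def by (blast dest: selfadjoint_opD(1))
  then have "(\<lambda>n. F (U n x)) \<longlonglongrightarrow> F (H x)" for x using H(2) by (rule bounded_linear.tendsto)
  then have "G = (\<lambda>x. F (H x))" by (intro ext LIMSEQ_unique[OF G(2)])
  with G(1) H(1) show ?case by blast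
qed

lemma represents_exists: "bdd_borel f \<Longrightarrow> \<exists>F. represents f F"
  by (drule represents_mult_indicator) blast

lemma represents_mult:
  assumes "bdd_borel f" "bdd_borel h" "represents f F" and H: "represents h H"
  shows "represents (\<lambda>t. f t * h t) (\<lambda>x. F (H x))"
proof -
  obtain K where K: "represents h K" "represents (\<lambda>t. f t * h t) (\<lambda>x. F (K x))"
    using represents_mult_exists[OF assms(1,3,2)] by blast
  with represents_unique[OF H K(1)] show ?thesis by simp
qed

end

subsection \<open>Application to null space networks\<close>

lemma network_layer_continuous:
  assumes "network_layer S T f"
  shows "continuous_on S f" "f ` S \<subseteq> T"
proof -
  obtain W \<sigma> where f: "f = \<sigma> \<circ> W" and W: "continuous_on S W" "W ` S \<subseteq> T"
    and \<sigma>: "continuous_on T \<sigma>" "\<sigma> ` T \<subseteq> T"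
    using assms by (auto simp: network_layer_def)
  show "continuous_on S f" unfolding f by (rule continuous_on_compose[OF W(1) continuous_on_subset[OF \<sigma>(1) W(2)]])
  show "f ` S \<subseteq> T" using W(2) \<sigma>(2) by (auto simp: f)
qed

lemma hidden_layers_continuous:
  assumes "hidden_layers H f"
  shows "continuous_on UNIV f \<and> range f \<subseteq> H"
  using assms
proof induction
  case (first_layer H f)
  then show ?case using network_layer_continuous by blast
next
  case (add_layer H f H' f')
  note f' = network_layer_continuous[OF add_layer.hyps(4)]
  have "continuous_on UNIV (f' \<circ> f)"
    using add_layer.IH by (intro continuous_on_compose continuous_on_subset[OF f'(1)]) auto
  moreover have "range (f' \<circ> f) \<subseteq> H'" using add_layer.IH f'(2) by auto
  ultimately show ?case by blast
qed

lemma layered_network_continuous: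
  assumes "layered_network TYPE('h::{real_inner,complete_space}) F"
  shows "continuous_on UNIV F"
  using assms unfolding layered_network_def
proof
  assume "network_layer UNIV UNIV F"
  then show ?thesis by (rule network_layer_continuous)
next
  assume "\<exists>(H :: 'h set) f f'. hidden_layers H f \<and> network_layer H UNIV f' \<and> F = f' \<circ> f"
  then obtain H f f' where H: "hidden_layers (H :: 'h set) f" "network_layer H UNIV f'" "F = f' \<circ> f" by blast
  show ?thesis
    unfolding H(3) using hidden_layers_continuous[OF H(1)] network_layer_continuous(1)[OF H(2)]
    by (blast intro: continuous_on_compose continuous_on_subset)
qed

text \<open>\<open>A x\<close> always lies in the domain of the Moore-Penrose inverse, whether or
  not the range is closed. There the description is met exactly by \<open>x - P x\<close>, with
  \<open>P\<close> the orthogonal projection onto the kernel.\<close>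

lemma ker_proj:
  fixes A :: "'x::{real_inner,complete_space} \<Rightarrow> 'y::{real_inner,complete_space}"
  assumes A: "bounded_linear A"
  shows "bounded_linear (ker_proj A)" "A (ker_proj A x) = 0"
proof -
  interpret A: bounded_linear A by fact
  have sub: "subspace {x. A x = 0}"
    by (auto simp: subspace_def A.zero A.add A.scaleR)
  have "closed {x. A x = 0}"
    by (intro closed_Collect_eq continuous_intros A.continuous_on)
  from orth_proj_exists[OF sub this]
  obtain P where P: "orth_proj P" "range P = {x. A x = 0}" "\<And>x v. A v = 0 \<Longrightarrow> (x - P x) \<bullet> v = 0"
    by blast
  have AP: "A (P x) = 0" for x using P(2) by blast
  have "moore_penrose A (A x) = x - P x" for x
    unfolding moore_penrose_def
  proof (rule the_equality)
    show "x - P x \<in> {u. A u = 0}\<^sup>\<bottom> \<and> A x - A (x - P x) \<in> (range A)\<^sup>\<bottom>"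
      using P(3)[of _ x] by (auto simp: orthogonal_comp_def orthogonal_def A.diff AP inner_commute)
  next
    fix u assume u: "u \<in> {u. A u = 0}\<^sup>\<bottom> \<and> A x - A u \<in> (range A)\<^sup>\<bottom>"
    \<comment> \<open>This vector lies in the range of \<open>A\<close> and in its orthogonal
      complement, so it is zero.\<close>
    have "A (x - u) \<bullet> (A x - A u) = 0"
      using u unfolding orthogonal_comp_def orthogonal_def by blast
    then have Axu: "A x = A u" by (simp add: A.diff)
    let ?v = "u - (x - P x)"
    have v: "A ?v = 0" by (simp add: A.diff AP Axu)
    have "?v \<bullet> u = 0" using u v unfolding orthogonal_comp_def orthogonal_def by blast
    moreover have "(x - P x) \<bullet> ?v = 0" using P(3)[OF v] .
    ultimately have "?v \<bullet> ?v = 0" by (simp only: inner_diff_right[of ?v u "x - P x"] inner_commute[of ?v "x - P x"])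
    then show "u = x - P x" by simp
  qed
  then have "ker_proj A = P" by (simp add: ker_proj_def fun_eq_iff)
  then show "bounded_linear (ker_proj A)" "A (ker_proj A x) = 0" using orth_projD(2)[OF P(1)] AP by auto
qed

lemma normal_op_positive:
  fixes A :: "'x::{real_inner,complete_space} \<Rightarrow> 'y::{real_inner,complete_space}"
  assumes A: "bounded_linear A"
  shows "positive_op (normal_op A)"
proof
  have adj: "adjoint A y \<bullet> x = y \<bullet> A x" for x y
    using adjoint_exists[OF A, of x y] by (simp add: inner_commute)
  show "selfadjoint_op (normal_op A)"
  proof (rule selfadjoint_opI)
    show "bounded_linear (normal_op A)"
      unfolding normal_op_def o_def by (rule bounded_linear_compose[OF bounded_linear_adjoint[OF A] A])
    show "normal_op A x \<bullet> y = x \<bullet> normal_op A y" for x y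
      by (simp add: normal_op_def adj adjoint_exists[OF A, symmetric])
  qed
  show "0 \<le> x \<bullet> normal_op A x" for x
    by (simp add: normal_op_def adjoint_exists[OF A, symmetric])
qed

locale bounded_op =
  fixes A :: "'x::{real_inner,complete_space} \<Rightarrow> 'y::{real_inner,complete_space}"
  assumes A: "bounded_linear A"
begin

sublocale A: bounded_linear A by (rule A)

sublocale normal: positive_op "normal_op A" by (rule normal_op_positive[OF A])

lemma is_spectral_measure_normal_op:
  "is_spectral_measure (spec_interval A) (normal_op A) (spectral_measure (spec_interval A) (normal_op A))"
  unfolding spectral_measure_def spec_interval_def
  by (rule someI[of "is_spectral_measure _ _", OF normal.is_spectral_measure_spec_proj])

sublocale spectral_family "spectral_measure (spec_interval A) (normal_op A)"
  using is_spectral_measure_normal_op by unfold_locales (simp add: is_spectral_measure_def)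

abbreviation on_spec :: "(real \<Rightarrow> real) \<Rightarrow> real \<Rightarrow> real" where
  "on_spec f \<equiv> \<lambda>t. indicator (spec_interval A) t * f t"

lemma normal_calc_represents:
  assumes f: "bdd_borel (on_spec f)"
  shows "represents (on_spec f) (normal_calc A f)"
proof -
  from represents_exists[OF f] obtain F where F: "represents (on_spec f) F" by blast
  have "normal_calc A f = F"
    unfolding normal_calc_def fun_calc_def set_lebesgue_integral_def real_scaleR_def
  proof (rule the_equality)
    show "selfadjoint_op F \<and> (\<forall>x. x \<bullet> F x = (LINT t|\<nu> x. on_spec f t))"
      using F unfolding represents_def .
    show "G = F" if "selfadjoint_op G \<and> (\<forall>x. x \<bullet> G x = (LINT t|\<nu> x. on_spec f t))" for G
      using represents_unique[OF _ F] that unfolding represents_def by blast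
  qed
  with F show ?thesis by simp
qed

lemma normal_op_represents: "represents (on_spec (\<lambda>t. t)) (normal_op A)"
  using is_spectral_measure_normal_op normal.selfadjoint
  by (simp add: is_spectral_measure_def represents_def set_lebesgue_integral_def)

lemma bdd_borel_on_spec_id: "bdd_borel (on_spec (\<lambda>t. t))"
  by (rule bdd_borelI[where M = "onorm (normal_op A)"])
    (auto simp: spec_interval_def indicator_def normal.onorm_nonneg)

lemma bdd_borel_on_spec_powr:
  assumes "\<mu> > 0" shows "bdd_borel (on_spec (\<lambda>t. t powr \<mu>))"
proof (rule bdd_borelI[where M = "onorm (normal_op A) powr \<mu>"])
  show "\<bar>on_spec (\<lambda>t. t powr \<mu>) t\<bar> \<le> onorm (normal_op A) powr \<mu>" for t
    using assms by (auto simp: spec_interval_def indicator_def intro!: powr_mono2)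
qed (auto simp: spec_interval_def)

text \<open>Continuity off the finite set \<open>D\<close> gives measurability with \<open>D\<close>
  cut out; restoring finitely many points preserves it.\<close>

lemma bdd_borel_on_spec_piecewise:
  assumes f: "piecewise_continuous 0 (onorm (normal_op A)) f"
    and M: "\<And>t. t \<in> spec_interval A \<Longrightarrow> \<bar>f t\<bar> \<le> M"
  shows "bdd_borel (on_spec f)"
proof (rule bdd_borelI[where M = "\<bar>M\<bar>"])
  show "\<bar>on_spec f t\<bar> \<le> \<bar>M\<bar>" for t
    using M[of t] by (auto simp: indicator_def)
  obtain D where D: "finite D" "continuous_on (spec_interval A - D) f"
    using f by (auto simp: piecewise_continuous_def spec_interval_def)
  have "spec_interval A - D \<in> sets borel"
    using D(1) by (auto simp: spec_interval_def finite_imp_closed)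
  from borel_measurable_continuous_on_indicator[OF this D(2)]
  have m: "(\<lambda>t. indicator (spec_interval A - D) t *\<^sub>R f t) \<in> borel_measurable borel" .
  show "on_spec f \<in> borel_measurable borel"
    by (rule measurable_discrete_difference[OF m countable_finite[OF D(1)]]) (auto simp: indicator_def)
qed

text \<open>The operator \<open>g(T) A\<^sup>*\<close> has adjoint \<open>A g(T)\<close>, and the
  squared norm of \<open>A (g(T) w)\<close> is the form of \<open>g(T) T g(T)\<close>, which
  represents \<open>t g(t)\<^sup>2\<close>. A bound \<open>c\<close> on that function thus enters
  only through its square root.\<close>

lemma normal_calc_adjoint_norm_le:
  assumes g: "bdd_borel (on_spec g)" and c: "c \<ge> 0"
    and le: "\<And>t. t \<in> spec_interval A \<Longrightarrow> \<bar>t * (g t)\<^sup>2\<bar> \<le> c"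
  shows "norm (normal_calc A g (adjoint A v)) \<le> sqrt c * norm v"
proof -
  let ?G = "normal_calc A g"
  define w where "w = ?G (adjoint A v)"
  note G = normal_calc_represents[OF g]
  have sym: "?G x \<bullet> y = x \<bullet> ?G y" for x y
    using G selfadjoint_opD(2) unfolding represents_def by blast
  note T = normal_op_represents and bT = bdd_borel_on_spec_id
  have "represents (\<lambda>t. on_spec g t * (on_spec (\<lambda>t. t) t * on_spec g t)) (\<lambda>x. ?G (normal_op A (?G x)))"
    by (intro represents_mult bdd_borel_mult g G T bT)
  moreover have "bdd_borel (\<lambda>t. on_spec g t * (on_spec (\<lambda>t. t) t * on_spec g t))"
    by (intro bdd_borel_mult g bT)
  moreover have "\<bar>on_spec g t * (on_spec (\<lambda>t. t) t * on_spec g t)\<bar> \<le> c" for t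
    using le[of t] c by (auto simp: indicator_def power2_eq_square mult_ac)
  ultimately have norm: "norm (?G (normal_op A (?G x))) \<le> c * norm x" for x
    by (rule represents_norm_le)
  have "(norm (A (?G w)))\<^sup>2 = w \<bullet> ?G (normal_op A (?G w))"
    by (simp add: power2_norm_eq_inner adjoint_exists[OF A] normal_op_def flip: sym)
  also have "\<dots> \<le> norm w * (c * norm w)"
    using norm_cauchy_schwarz norm mult_left_mono norm_ge_zero order_trans by metis
  also have "\<dots> = (sqrt c * norm w)\<^sup>2" using c by (simp add: power2_eq_square)
  finally have Aw: "norm (A (?G w)) \<le> sqrt c * norm w"
    by (rule power2_le_imp_le) (use c in simp)
  have "norm w * norm w = A (?G w) \<bullet> v"
    unfolding adjoint_exists[OF A] sym w_def[symmetric] by (simp add: norm_eq_sqrt_inner)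
  also have "\<dots> \<le> norm (A (?G w)) * norm v" by (rule norm_cauchy_schwarz)
  also have "\<dots> \<le> (sqrt c * norm w) * norm v" using Aw by (intro mult_right_mono) auto
  finally have "norm w \<le> sqrt c * norm v"
    using c by (cases "w = 0") (auto simp: mult_ac)
  then show ?thesis by (simp add: w_def)
qed

text \<open>The operator represents \<open>p(t) (t g(t) - 1)\<close>. With \<open>p\<close> the
  power \<mu> this is where the source condition meets the qualification of the filter.\<close>

lemma normal_calc_residual_norm_le:
  assumes g: "bdd_borel (on_spec g)" and p: "bdd_borel (on_spec p)" and c: "c \<ge> 0"
    and le: "\<And>t. t \<in> spec_interval A \<Longrightarrow> \<bar>p t\<bar> * \<bar>1 - t * g t\<bar> \<le> c"
  shows "norm (normal_calc A g (normal_op A (normal_calc A p w)) - normal_calc A p w) \<le> c * norm w"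
proof (rule represents_diff_norm_le)
  note G = normal_calc_represents[OF g] and P = normal_calc_represents[OF p]
  note T = normal_op_represents and bT = bdd_borel_on_spec_id
  let ?f = "\<lambda>t. on_spec g t * (on_spec (\<lambda>t. t) t * on_spec p t)"
  show "represents ?f (\<lambda>w. normal_calc A g (normal_op A (normal_calc A p w)))"
    by (intro represents_mult bdd_borel_mult g G T bT p P)
  show "bdd_borel ?f" by (intro bdd_borel_mult g bT p)
  show "represents (on_spec p) (normal_calc A p)" "bdd_borel (on_spec p)" by fact+
  show "\<bar>?f t - on_spec p t\<bar> \<le> c" for t
  proof (cases "t \<in> spec_interval A")
    case True
    have "\<bar>?f t - on_spec p t\<bar> = \<bar>p t * (1 - t * g t)\<bar>"
      using True by (subst abs_minus_commute) (simp add: algebra_simps)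
    then show ?thesis using le[OF True] by (simp add: abs_mult)
  qed (use c in simp)
qed

end

text \<open>With \<open>b = 1 / (2 * \<mu> + 1)\<close> the lower bound on \<alpha> makes its root
  at least \<open>sqrt d * (\<delta> / \<rho>) powr b\<close>. Dividing \<delta> by it leaves the
  exponent \<open>1 - b\<close>, the same as in \<open>approximation_rate\<close>.\<close>

lemma noise_rate:
  fixes \<mu> \<rho> \<delta> d k \<alpha> :: real
  assumes pos: "\<mu> > 0" "\<rho> > 0" "\<delta> > 0" "d > 0" "k \<ge> 0"
    and \<alpha>: "d * (\<delta> / \<rho>) powr (2 / (2 * \<mu> + 1)) \<le> \<alpha>"
  shows "sqrt (k / \<alpha>) * \<delta> \<le> sqrt (k / d) * \<rho> powr (1 / (2 * \<mu> + 1)) * \<delta> powr (2 * \<mu> / (2 * \<mu> + 1))"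
proof -
  define b where "b = 1 / (2 * \<mu> + 1)"
  have b2: "2 / (2 * \<mu> + 1) = b + b" and b1: "2 * \<mu> / (2 * \<mu> + 1) = 1 - b"
    using pos by (simp_all add: b_def field_simps)
  let ?q = "(\<delta> / \<rho>) powr b"
  have q: "?q > 0" using pos by simp
  have "d * (?q * ?q) \<le> \<alpha>" using \<alpha> unfolding b2 powr_add .
  then have "k / \<alpha> \<le> k / (d * (?q * ?q))"
    using pos q by (intro frac_le mult_pos_pos) auto
  then have "sqrt (k / \<alpha>) \<le> sqrt (k / d) / ?q"
  proof -
    have "sqrt (k / \<alpha>) \<le> sqrt (k / (d * (?q * ?q)))" by (rule real_sqrt_le_mono) fact
    also have "\<dots> = sqrt (k / d) / ?q" using q by (simp only: real_sqrt_divide real_sqrt_mult real_sqrt_abs2) simp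
    finally show ?thesis .
  qed
  then have "sqrt (k / \<alpha>) * \<delta> \<le> sqrt (k / d) / ?q * \<delta>" using pos by (intro mult_right_mono) auto
  also have "\<dots> = sqrt (k / d) * \<rho> powr b * \<delta> powr (1 - b)"
    using pos by (simp add: powr_divide powr_diff)
  finally show ?thesis unfolding b1 b_def .
qed

lemma approximation_rate:
  fixes \<mu> \<rho> \<delta> d \<alpha> :: real
  assumes pos: "\<mu> > 0" "\<rho> > 0" "\<delta> > 0" "d > 0" "\<alpha> > 0"
    and \<alpha>: "\<alpha> \<le> d * (\<delta> / \<rho>) powr (2 / (2 * \<mu> + 1))"
  shows "\<alpha> powr \<mu> \<le> d powr \<mu> / \<rho> powr (2 * \<mu> / (2 * \<mu> + 1)) * \<delta> powr (2 * \<mu> / (2 * \<mu> + 1))"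
proof -
  have "\<alpha> powr \<mu> \<le> (d * (\<delta> / \<rho>) powr (2 / (2 * \<mu> + 1))) powr \<mu>"
    using pos \<alpha> by (intro powr_mono2) auto
  also have "\<dots> = d powr \<mu> * (\<delta> / \<rho>) powr (2 * \<mu> / (2 * \<mu> + 1))"
    using pos by (simp add: powr_mult powr_powr)
  also have "\<dots> = d powr \<mu> / \<rho> powr (2 * \<mu> / (2 * \<mu> + 1)) * \<delta> powr (2 * \<mu> / (2 * \<mu> + 1))"
    using pos by (simp add: powr_divide)
  finally show ?thesis .
qed

theorem theorem3p4:
  fixes A :: "'x::{real_inner,complete_space} \<Rightarrow> 'y::{real_inner,complete_space}"
    and N :: "'x \<Rightarrow> 'x"
    and g :: "real \<Rightarrow> real \<Rightarrow> real"
    and Q :: "real \<Rightarrow> 'x \<Rightarrow> 'x"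
    and alpha_star :: "real \<Rightarrow> 'y \<Rightarrow> real"
    and \<mu> \<rho> \<alpha>\<^sub>0 c\<^sub>1 c\<^sub>2 :: real
    and x :: 'x
  assumes A: "bounded_linear A"
    and N: "layered_network TYPE('h::{real_inner,complete_space}) N"
    and lipschitz: "\<exists>K. K-lipschitz_on UNIV (\<lambda>z. ker_proj A (N z))"
    and pos: "\<mu> > 0" "\<rho> > 0" "\<alpha>\<^sub>0 > 0" "c\<^sub>1 > 0" "c\<^sub>2 > 0"
    and filter: "regularizing_filter A g"
    and qualification: "\<forall>\<alpha>>0. \<forall>t\<in>spec_interval A. t powr \<mu> * \<bar>1 - t * g \<alpha> t\<bar> \<le> c\<^sub>1 * \<alpha> powr \<mu>"
    and sup_bound: "\<forall>\<alpha>. 0 < \<alpha> \<and> \<alpha> < \<alpha>\<^sub>0 \<longrightarrow> (\<forall>t\<in>spec_interval A. \<bar>g \<alpha> t\<bar> \<le> c\<^sub>2 / \<alpha>)"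
    and choice_pos: "\<forall>\<delta>>0. \<forall>y. alpha_star \<delta> y > 0"
    and choice_rate: "\<exists>d\<^sub>1>0. \<exists>d\<^sub>2>0. \<forall>\<^sub>F \<delta> in at_right 0. \<forall>y.
          d\<^sub>1 * (\<delta> / \<rho>) powr (2 / (2 * \<mu> + 1)) \<le> alpha_star \<delta> y \<and>
          alpha_star \<delta> y \<le> d\<^sub>2 * (\<delta> / \<rho>) powr (2 / (2 * \<mu> + 1))"
    and Q: "\<forall>\<alpha>>0. bounded_linear (Q \<alpha>)"
    and Q_rate: "\<exists>c. \<forall>\<^sub>F \<delta> in at_right 0. \<forall>y.
          onorm (\<lambda>z. Q (alpha_star \<delta> y) z - ker_proj A z) \<le> c * \<delta> powr (2 * \<mu> / (2 * \<mu> + 1))"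
    and x: "x \<in> range (null_space_net A N \<circ> normal_calc A (\<lambda>t. t powr \<mu>))"
  shows "\<exists>c. \<forall>\<^sub>F \<delta> in at_right 0. \<forall>y. norm (A x - y) \<le> \<delta> \<longrightarrow>
           norm (null_space_reg A N g Q (alpha_star \<delta> y) y - x) \<le> c * \<delta> powr (2 * \<mu> / (2 * \<mu> + 1))"
proof -
  interpret bounded_op A by (rule bounded_op.intro[OF A])
  define a where "a = 2 * \<mu> / (2 * \<mu> + 1)"
  have a: "a > 0" using pos by (simp add: a_def)
  interpret P: bounded_linear "ker_proj A" by (rule ker_proj(1)[OF A])
  let ?\<Phi> = "normal_calc A"
  define p where "p t = t powr \<mu>" for t :: real
  have p: "bdd_borel (on_spec p)" unfolding p_def by (rule bdd_borel_on_spec_powr[OF pos(1)])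
  obtain w where xw: "x = null_space_net A N (?\<Phi> p w)" using x by (auto simp: p_def[abs_def])
  define u where "u = ?\<Phi> p w"
  have xu: "x = u + ker_proj A (N u)" using xw by (simp add: null_space_net_def u_def)
  have Ax: "A x = A u" by (simp add: xu A.add ker_proj(2)[OF A])
  obtain C where C: "C > 0" "\<And>\<alpha> t. \<alpha> > 0 \<Longrightarrow> t \<in> spec_interval A \<Longrightarrow> \<bar>t * g \<alpha> t\<bar> \<le> C"
    using filter by (auto simp: regularizing_filter_def)
  obtain K where K: "K-lipschitz_on UNIV (\<lambda>z. ker_proj A (N z))" using lipschitz by blast
  obtain d\<^sub>1 d\<^sub>2 where d: "d\<^sub>1 > 0" "d\<^sub>2 > 0" and rate: "\<forall>\<^sub>F \<delta> in at_right 0. \<forall>y.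
      d\<^sub>1 * (\<delta> / \<rho>) powr (2 / (2 * \<mu> + 1)) \<le> alpha_star \<delta> y \<and>
      alpha_star \<delta> y \<le> d\<^sub>2 * (\<delta> / \<rho>) powr (2 / (2 * \<mu> + 1))"
    using choice_rate by blast
  obtain c where c: "\<forall>\<^sub>F \<delta> in at_right 0. \<forall>y.
      onorm (\<lambda>z. Q (alpha_star \<delta> y) z - ker_proj A z) \<le> c * \<delta> powr a"
    using Q_rate unfolding a_def by blast
  \<comment> \<open>The first summand comes from \<open>noise_rate\<close> with
    \<open>k = C * c\<^sub>2\<close> and the lower constant \<open>d\<^sub>1\<close>, the second
    from \<open>approximation_rate\<close> with the upper constant \<open>d\<^sub>2\<close>.\<close>
  define C1 where "C1 = sqrt (C * c\<^sub>2 / d\<^sub>1) * \<rho> powr (1 / (2 * \<mu> + 1)) + c\<^sub>1 * (d\<^sub>2 powr \<mu> / \<rho> powr a) * norm w"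
  have linear_error: "norm (?\<Phi> (g \<alpha>) (adjoint A y) - u) \<le> C1 * \<delta> powr a"
    if \<delta>: "\<delta> > 0" and \<alpha>: "0 < \<alpha>" "\<alpha> < \<alpha>\<^sub>0" "d\<^sub>1 * (\<delta> / \<rho>) powr (2 / (2 * \<mu> + 1)) \<le> \<alpha>"
      "\<alpha> \<le> d\<^sub>2 * (\<delta> / \<rho>) powr (2 / (2 * \<mu> + 1))" and y: "norm (A x - y) \<le> \<delta>" for \<delta> \<alpha> y
  proof -
    \<comment> \<open>Boundedness of the filter function is read off \<open>sup_bound\<close>, hence
      the restriction to \<open>\<alpha> < \<alpha>\<^sub>0\<close>, which \<open>below\<close>
      secures for small \<delta>.\<close>
    have g: "bdd_borel (on_spec (g \<alpha>))"
      using filter \<alpha> sup_bound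
      by (intro bdd_borel_on_spec_piecewise[where M = "c\<^sub>2 / \<alpha>"]) (auto simp: regularizing_filter_def)
    interpret G: bounded_linear "?\<Phi> (g \<alpha>)"
      using normal_calc_represents[OF g] unfolding represents_def by (blast dest: selfadjoint_opD(1))
    interpret A': bounded_linear "adjoint A" by (rule bounded_linear_adjoint[OF A])
    \<comment> \<open>One factor \<open>g \<alpha> t\<close> is absorbed with \<open>t\<close> by
      the filter bound \<open>C\<close>; the other is controlled by
      \<open>sup_bound\<close>.\<close>
    have "\<bar>t * (g \<alpha> t)\<^sup>2\<bar> \<le> C * (c\<^sub>2 / \<alpha>)" if "t \<in> spec_interval A" for t
    proof -
      have "\<bar>t * (g \<alpha> t)\<^sup>2\<bar> = \<bar>t * g \<alpha> t\<bar> * \<bar>g \<alpha> t\<bar>" by (simp add: power2_eq_square abs_mult)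
      also have "\<dots> \<le> C * (c\<^sub>2 / \<alpha>)"
        using C(1) C(2)[OF \<alpha>(1) that] sup_bound \<alpha> that by (intro mult_mono) auto
      finally show ?thesis .
    qed
    then have "norm (?\<Phi> (g \<alpha>) (adjoint A (y - A x))) \<le> sqrt (C * (c\<^sub>2 / \<alpha>)) * norm (y - A x)"
      using C(1) pos \<alpha> by (intro normal_calc_adjoint_norm_le g) auto
    also have "\<dots> \<le> sqrt (C * c\<^sub>2 / \<alpha>) * \<delta>"
      using y C(1) pos \<alpha> by (simp add: norm_minus_commute mult_left_mono)
    also have "\<dots> \<le> sqrt (C * c\<^sub>2 / d\<^sub>1) * \<rho> powr (1 / (2 * \<mu> + 1)) * \<delta> powr a"
      unfolding a_def using C(1) pos d \<delta> \<alpha> by (intro noise_rate) auto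
    finally have noise: "norm (?\<Phi> (g \<alpha>) (adjoint A (y - A x)))
      \<le> sqrt (C * c\<^sub>2 / d\<^sub>1) * \<rho> powr (1 / (2 * \<mu> + 1)) * \<delta> powr a" .
    have "norm (?\<Phi> (g \<alpha>) (normal_op A u) - u) \<le> c\<^sub>1 * \<alpha> powr \<mu> * norm w"
      unfolding u_def using qualification \<alpha>(1) pos
      by (intro normal_calc_residual_norm_le g p) (auto simp: p_def)
    also have "\<dots> \<le> c\<^sub>1 * (d\<^sub>2 powr \<mu> / \<rho> powr a * \<delta> powr a) * norm w"
      unfolding a_def using pos d \<delta> \<alpha> by (intro mult_right_mono mult_left_mono approximation_rate) auto
    finally have approximation: "norm (?\<Phi> (g \<alpha>) (normal_op A u) - u)
      \<le> c\<^sub>1 * (d\<^sub>2 powr \<mu> / \<rho> powr a * \<delta> powr a) * norm w" .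
    have "?\<Phi> (g \<alpha>) (adjoint A y) - u
      = ?\<Phi> (g \<alpha>) (adjoint A (y - A x)) + (?\<Phi> (g \<alpha>) (normal_op A u) - u)"
      by (simp add: Ax A'.diff G.diff normal_op_def)
    then show ?thesis
      using norm_triangle_ineq[of "?\<Phi> (g \<alpha>) (adjoint A (y - A x))" "?\<Phi> (g \<alpha>) (normal_op A u) - u"]
        noise approximation by (simp add: C1_def algebra_simps)
  qed
  have "isCont N u"
    using layered_network_continuous[OF N] by (simp add: continuous_on_eq_continuous_at)
  \<comment> \<open>The Lipschitz condition concerns only the kernel component of \<open>N\<close>,
    so the full norm of \<open>N z\<close> is bounded by continuity at \<open>u\<close>. The
    oscillation bound 1 is arbitrary.\<close>
  then obtain \<eta> where \<eta>: "\<eta> > 0" "\<And>z. dist z u < \<eta> \<Longrightarrow> dist (N z) (N u) < 1"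
    unfolding continuous_at_eps_delta by (meson zero_less_one)
  have nonneg: "\<forall>\<^sub>F \<delta> :: real in at_right 0. 0 \<le> \<delta>"
    by (rule eventually_mono[OF eventually_at_right_less]) simp
  \<comment> \<open>At base 0 the limit of \<open>powr\<close> requires a positive exponent and an
    eventually nonnegative base, supplied by \<open>a\<close> and \<open>nonneg\<close>.\<close>
  have "((\<lambda>\<delta>. C1 * \<delta> powr a) \<longlongrightarrow> C1 * 0 powr a) (at_right 0)"
    using a nonneg by (intro tendsto_mult_left tendsto_powr' tendsto_ident_at tendsto_const) auto
  then have small: "\<forall>\<^sub>F \<delta> in at_right 0. C1 * \<delta> powr a < \<eta>"
    using \<eta>(1) by (intro order_tendstoD) auto
  have "((\<lambda>\<delta>. d\<^sub>2 * (\<delta> / \<rho>) powr (2 / (2 * \<mu> + 1))) \<longlongrightarrow> d\<^sub>2 * (0 / \<rho>) powr (2 / (2 * \<mu> + 1))) (at_right 0)"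
    using pos eventually_mono[OF nonneg, of "\<lambda>\<delta>. 0 \<le> \<delta> / \<rho>"]
    by (intro tendsto_mult_left tendsto_powr' tendsto_divide tendsto_ident_at tendsto_const) auto
  then have below: "\<forall>\<^sub>F \<delta> in at_right 0. d\<^sub>2 * (\<delta> / \<rho>) powr (2 / (2 * \<mu> + 1)) < \<alpha>\<^sub>0"
    using pos by (intro order_tendstoD) auto
  have "\<forall>\<^sub>F \<delta> in at_right 0. \<forall>y. norm (A x - y) \<le> \<delta> \<longrightarrow>
    norm (null_space_reg A N g Q (alpha_star \<delta> y) y - x) \<le> (C1 + K * C1 + c * (norm (N u) + 1)) * \<delta> powr a"
    using rate c small below eventually_at_right_less
  proof eventually_elim
    case (elim \<delta>)
    show ?case
    proof (intro allI impI)
      fix y assume y: "norm (A x - y) \<le> \<delta>"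
      define \<alpha> where "\<alpha> = alpha_star \<delta> y"
      define z where "z = ?\<Phi> (g \<alpha>) (adjoint A y)"
      have \<alpha>: "\<alpha> > 0" using choice_pos elim by (simp add: \<alpha>_def)
      have lin: "norm (z - u) \<le> C1 * \<delta> powr a"
        unfolding z_def using elim y \<alpha> by (intro linear_error) (auto simp: \<alpha>_def intro: le_less_trans)
      have "norm (ker_proj A (N z) - ker_proj A (N u)) \<le> K * norm (z - u)"
        using lipschitz_onD[OF K, of z u] by (simp add: dist_norm)
      also have "\<dots> \<le> K * (C1 * \<delta> powr a)"
        using lin lipschitz_on_nonneg[OF K] by (rule mult_left_mono)
      finally have net: "norm (ker_proj A (N z) - ker_proj A (N u)) \<le> K * (C1 * \<delta> powr a)" .
      have "dist (N z) (N u) < 1" using lin elim by (intro \<eta>(2)) (simp add: dist_norm)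
      then have Nz: "norm (N z) \<le> norm (N u) + 1"
        using norm_triangle_sub[of "N z" "N u"] by (simp add: dist_norm)
      have bl: "bounded_linear (\<lambda>v. Q \<alpha> v - ker_proj A v)"
        using Q \<alpha> by (intro bounded_linear_sub P.bounded_linear_axioms) auto
      have Q_le: "onorm (\<lambda>v. Q \<alpha> v - ker_proj A v) \<le> c * \<delta> powr a"
        using elim by (simp add: \<alpha>_def)
      have "norm (Q \<alpha> (N z) - ker_proj A (N z)) \<le> onorm (\<lambda>v. Q \<alpha> v - ker_proj A v) * norm (N z)"
        by (rule onorm[OF bl])
      \<comment> \<open>No sign of \<open>c\<close> is assumed; the product
        \<open>c * \<delta> powr a\<close> is nonnegative because it dominates an operator
        norm.\<close>
      also have "\<dots> \<le> (c * \<delta> powr a) * (norm (N u) + 1)"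
        using order_trans[OF onorm_pos_le[OF bl] Q_le] by (intro mult_mono Q_le Nz) auto
      finally have proj: "norm (Q \<alpha> (N z) - ker_proj A (N z)) \<le> (c * \<delta> powr a) * (norm (N u) + 1)" .
      have "null_space_reg A N g Q \<alpha> y - x = (z - u) + (ker_proj A (N z) - ker_proj A (N u))
        + (Q \<alpha> (N z) - ker_proj A (N z))"
        by (simp add: null_space_reg_def z_def xu)
      also have "norm \<dots> \<le> norm (z - u) + norm (ker_proj A (N z) - ker_proj A (N u))
        + norm (Q \<alpha> (N z) - ker_proj A (N z))"
        by (intro norm_triangle_le add_right_mono norm_triangle_ineq)
      also have "\<dots> \<le> (C1 + K * C1 + c * (norm (N u) + 1)) * \<delta> powr a"
        using lin net proj by (simp add: algebra_simps)
      finally show "norm (null_space_reg A N g Q (alpha_star \<delta> y) y - x)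
        \<le> (C1 + K * C1 + c * (norm (N u) + 1)) * \<delta> powr a" by (simp add: \<alpha>_def)
    qed
  qed
  then show ?thesis unfolding a_def by blast
qed

end
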